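(* Let $\Lambda$ be a countable finitely aligned higher-rank graph and $\mathcal G_\Lambda$ its boundary path groupoid, with unit space $\mathcal G_\Lambda^0=\partial\Lambda$. Then the orbit space $\mathcal G_\Lambda^0/\mathcal G_\Lambda$ is $T_0$ if and only if for each $x\in\partial\Lambda$ there exist $\mu\in\Lambda$ and a finite set $F\subseteq s(\mu)\Lambda$ such that $Z(\mu\setminus F)\cap\mathcal O_x=\{x\}$.
   Context: For $k\ge 1$, a $k$-graph (higher-rank graph) is a small category $\Lambda$ with a degree functor $d:\Lambda\to\mathbb N^k$ satisfying the factorization property: if $d(\lambda)=m+n$ there are unique $\mu,\nu\in\Lambda$ with $\lambda=\mu\nu$, $d(\mu)=m$, $d(\nu)=n$. Elements are called paths, $r,s$ are range and source, $\Lambda^0=d^{-1}(0)$ is identified with the objects; $v\Lambda=\{\lambda: r(\lambda)=v\}$; for $0\le p\le q\le d(\lambda)$, $\lambda(p,q)$ is the unique path with $\lambda=\lambda'\lambda(p,q)\lambda''$, $d(\lambda')=p$, $d(\lambda(p,q))=q-p$. $\Lambda$ is countable if it has countably many paths. Put $\Lambda^{\min}(\lambda,\mu)=\{(\rho,\tau)\in\Lambda\times\Lambda:\lambda\rho=\mu\tau,\ d(\lambda\rho)=d(\lambda)\vee d(\mu)\}$ (coordinatewise maximum). $\Lambda$ is finitely aligned if $\Lambda^{\min}(\lambda,\mu)$ is finite for all $\lambda,\mu$. A subset $E\subseteq v\Lambda$ is exhaustive if for every $\mu\in v\Lambda$ there is $\lambda\in E$ with $\Lambda^{\min}(\lambda,\mu)\ne\emptyset$.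 For $m\in(\mathbb N\cup\{\infty\})^k$ let $\Omega_{k,m}$ be the $k$-graph $\{(p,q)\in\mathbb N^k\times\mathbb N^k: p\le q\le m\}$ with $r(p,q)=(p,p)$, $s(p,q)=(q,q)$, $(p,q)(q,t)=(p,t)$, $d(p,q)=q-p$; write $p$ for $(p,p)$. A boundary path is a degree-preserving functor $x:\Omega_{k,m}\to\Lambda$, with $d(x):=m$, such that for all $n\in\mathbb N^k$ with $n\le m$ and every finite exhaustive $E\subseteq x(n)\Lambda$ there is $\lambda\in E$ with $n+d(\lambda)\le m$ and $x(n,n+d(\lambda))=\lambda$. $\partial\Lambda$ is the set of boundary paths; $r(x)=x(0)$. For $p\in\mathbb N^k$ with $p\le d(x)$, the shift $\sigma^p(x)$ has degree $d(x)-p$ and $\sigma^p(x)(a,b)=x(a+p,b+p)$. For $\mu\in\Lambda$ and $x \in \partial\Lambda$ with $r(x)=s(\mu)$, $\mu x$ is the unique boundary path of degree $d(\mu)+d(x)$ with $(\mu x)(0,d(\mu))=\mu$ and $\sigma^{d(\mu)}(\mu x)=x$. For $\mu\in\Lambda$ and finite $F\subseteq s(\mu)\Lambda$ let $Z(\mu)=\{\mu x\in\partial\Lambda\}=\{y\in\partial\Lambda: d(y)\geq d(\mu),\ y(0,d(\mu))=\mu\}$ and $Z(\mu\setminus F)=Z(\mu)\setminus\bigcup_{\nu\in F}Z(\mu\nu)$. The sets $Z(\mu\setminus F)$ form a base for the topology of $\partial\Lambda$. The boundary path groupoid is $\mathcal G_\Lambda=\{(x,p-q,y): x,y\in\partial\Lambda,\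 p,q\in\mathbb N^k,\ p\le d(x),\ q\le d(y),\ \sigma^p(x)=\sigma^q(y)\}$ with range $x$, source $y$, product $(x,m,y)(y,n,z)=(x,m+n,z)$, inverse $(x,m,y)^{-1}=(y,-m,x)$; a base for its topology consists of the sets $Z(\lambda *_s\mu)\setminus\bigcup_{\nu\in F}Z(\lambda\nu *_s\mu\nu)$ with $s(\lambda)=s(\mu)$, $F\subseteq s(\lambda)\Lambda$ finite, where $Z(\lambda *_s\mu)=\{(\lambda z,d(\lambda)-d(\mu),\mu z): z\in\partial\Lambda,\ r(z)=s(\lambda)\}$. Its unit space is identified with $\partial\Lambda$. The orbit $\mathcal O_x$ of $x$ is the set of $y\in\partial\Lambda$ for which there are $p\le d(x)$, $q\le d(y)$ in $\mathbb N^k$ with $\sigma^p(x)=\sigma^q(y)$. The orbit space $\mathcal G_\Lambda^0/\mathcal G_\Lambda$ is the set of orbits with the quotient topology from $\partial\Lambda$. *)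

theory Defs
  imports "HOL-Analysis.Analysis" "HOL-Library.Function_Algebras" "HOL-Library.Extended_Nat"
begin

text \<open>
  The monoid of \<open>k\<close>-tuples of naturals is \<open>'k \<Rightarrow> nat\<close> with \<open>'k\<close> a finite type (so
  \<open>k = CARD('k) \<ge> 1\<close>), carrying the pointwise order and algebraic operations; \<open>sup\<close> is the
  coordinatewise maximum. Tuples that may have infinite entries are of type \<open>'k \<Rightarrow> enat\<close>.
\<close>

definition emb :: "('k \<Rightarrow> nat) \<Rightarrow> ('k \<Rightarrow> enat)" where
  "emb n = (\<lambda>i. enat (n i))"

section \<open>Higher-rank graphs\<close>

text \<open>
  Objects are identified with their identity morphisms, so a category is given by its morphisms
  alone, and \<open>rng\<close>, \<open>src\<close> take values in the identity morphisms. The composite \<open>cmp G a b\<close> is only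
  meaningful if \<open>src G a = rng G b\<close>.
\<close>

record ('a, 'k) hrgraph =
  paths :: "'a set"
  rng :: "'a \<Rightarrow> 'a"
  src :: "'a \<Rightarrow> 'a"
  cmp :: "'a \<Rightarrow> 'a \<Rightarrow> 'a"
  deg :: "'a \<Rightarrow> 'k \<Rightarrow> nat"

locale higher_rank_graph =
  fixes G :: "('a, 'k::finite) hrgraph"
  assumes rng_in: "a \<in> paths G \<Longrightarrow> rng G a \<in> paths G"
    and src_in: "a \<in> paths G \<Longrightarrow> src G a \<in> paths G"
    and rng_rng: "a \<in> paths G \<Longrightarrow> rng G (rng G a) = rng G a"
    and src_rng: "a \<in> paths G \<Longrightarrow> src G (rng G a) = rng G a"
    and rng_src: "a \<in> paths G \<Longrightarrow> rng G (src G a) = src G a"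
    and src_src: "a \<in> paths G \<Longrightarrow> src G (src G a) = src G a"
    and cmp_in: "\<lbrakk>a \<in> paths G; b \<in> paths G; src G a = rng G b\<rbrakk> \<Longrightarrow> cmp G a b \<in> paths G"
    and rng_cmp: "\<lbrakk>a \<in> paths G; b \<in> paths G; src G a = rng G b\<rbrakk> \<Longrightarrow> rng G (cmp G a b) = rng G a"
    and src_cmp: "\<lbrakk>a \<in> paths G; b \<in> paths G; src G a = rng G b\<rbrakk> \<Longrightarrow> src G (cmp G a b) = src G b"
    and cmp_rng_left: "a \<in> paths G \<Longrightarrow> cmp G (rng G a) a = a"
    and cmp_src_right: "a \<in> paths G \<Longrightarrow> cmp G a (src G a) = a"
    and cmp_assoc: "\<lbrakk>a \<in> paths G; b \<in> paths G; c \<in> paths G; src G a = rng G b; src G b = rng G c\<rbrakk>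
          \<Longrightarrow> cmp G (cmp G a b) c = cmp G a (cmp G b c)"
    and deg_id: "a \<in> paths G \<Longrightarrow> deg G (rng G a) = 0 \<and> deg G (src G a) = 0"
    and deg_cmp: "\<lbrakk>a \<in> paths G; b \<in> paths G; src G a = rng G b\<rbrakk>
          \<Longrightarrow> deg G (cmp G a b) = deg G a + deg G b"
    and factorization: "\<lbrakk>a \<in> paths G; deg G a = m + n\<rbrakk>
          \<Longrightarrow> \<exists>!p. fst p \<in> paths G \<and> snd p \<in> paths G \<and> src G (fst p) = rng G (snd p)
                 \<and> a = cmp G (fst p) (snd p) \<and> deg G (fst p) = m \<and> deg G (snd p) = n"
begin

lemma deg_zero_iff_identity:
  assumes "a \<in> paths G"
  shows "deg G a = 0 \<longleftrightarrow> rng G a = a"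
proof
  assume z: "deg G a = 0"
  let ?P = "\<lambda>p. fst p \<in> paths G \<and> snd p \<in> paths G \<and> src G (fst p) = rng G (snd p)
                 \<and> a = cmp G (fst p) (snd p) \<and> deg G (fst p) = 0 \<and> deg G (snd p) = 0"
  have "\<exists>!p. ?P p" using factorization[of a 0 0] assms z by simp
  moreover have "?P (rng G a, a)" "?P (a, src G a)"
    using assms z deg_id[OF assms] by (auto simp: rng_in src_in src_rng rng_src cmp_rng_left cmp_src_right)
  ultimately have "(rng G a, a) = (a, src G a)" by blast
  then show "rng G a = a" by simp
next
  assume "rng G a = a"
  then show "deg G a = 0" using deg_id[OF assms] by simp
qed

end

definition vpaths :: "('a, 'k) hrgraph \<Rightarrow> 'a \<Rightarrow> 'a set" where
  "vpaths G v = {a \<in> paths G. rng G a = v}"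

definition min_ext :: "('a, 'k) hrgraph \<Rightarrow> 'a \<Rightarrow> 'a \<Rightarrow> ('a \<times> 'a) set" where
  "min_ext G a b = {(p, t). p \<in> paths G \<and> t \<in> paths G \<and> src G a = rng G p \<and> src G b = rng G t
     \<and> cmp G a p = cmp G b t \<and> deg G (cmp G a p) = sup (deg G a) (deg G b)}"

definition finitely_aligned :: "('a, 'k) hrgraph \<Rightarrow> bool" where
  "finitely_aligned G \<longleftrightarrow> (\<forall>a\<in>paths G. \<forall>b\<in>paths G. finite (min_ext G a b))"

definition exhaustive :: "('a, 'k) hrgraph \<Rightarrow> 'a \<Rightarrow> 'a set \<Rightarrow> bool" where
  "exhaustive G v E \<longleftrightarrow> E \<subseteq> vpaths G v \<and> (\<forall>b\<in>vpaths G v. \<exists>a\<in>E. min_ext G a b \<noteq> {})"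

section \<open>Boundary paths\<close>

definition omega :: "('k \<Rightarrow> enat) \<Rightarrow> (('k \<Rightarrow> nat) \<times> ('k \<Rightarrow> nat), 'k) hrgraph" where
  "omega m = \<lparr> paths = {(p, q). p \<le> q \<and> emb q \<le> m},
               rng = (\<lambda>(p, q). (p, p)),
               src = (\<lambda>(p, q). (q, q)),
               cmp = (\<lambda>(p, q) (q', t). (p, t)),
               deg = (\<lambda>(p, q). q - p) \<rparr>"

lemma emb_mono: "p \<le> q \<Longrightarrow> emb q \<le> m \<Longrightarrow> emb p \<le> m"
  by (rule order_trans[of _ "emb q"]) (simp_all add: emb_def le_fun_def)

lemma higher_rank_graph_omega: "higher_rank_graph (omega m :: (_, 'k::finite) hrgraph)"
proof
  fix a :: "('k \<Rightarrow> nat) \<times> ('k \<Rightarrow> nat)" and k l :: "'k \<Rightarrow> nat"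
  assume a: "a \<in> paths (omega m)" and d: "deg (omega m) a = k + l"
  obtain p q where pq: "a = (p, q)" by force
  have le: "p \<le> q" "emb q \<le> m" and qp: "q - p = k + l"
    using a d by (simp_all add: omega_def pq)
  have q: "q = p + k + l"
  proof
    fix i
    have "p i \<le> q i" using le(1) by (simp add: le_fun_def)
    moreover have "q i - p i = k i + l i" using fun_cong[OF qp, of i] by simp
    ultimately show "q i = (p + k + l) i" by simp
  qed
  have m: "emb (p + k) \<le> m" by (rule emb_mono[OF _ le(2)]) (simp add: q le_fun_def)
  have split: "t = p + k" if "p \<le> t" "t - p = k" for t :: "'k \<Rightarrow> nat"
  proof
    fix i
    show "t i = (p + k) i"
      using that(1) fun_cong[OF that(2), of i] by (simp add: le_fun_def) (metis le_add_diff_inverse)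
  qed
  show "\<exists>!u. fst u \<in> paths (omega m) \<and> snd u \<in> paths (omega m)
      \<and> src (omega m) (fst u) = rng (omega m) (snd u)
      \<and> a = cmp (omega m) (fst u) (snd u) \<and> deg (omega m) (fst u) = k \<and> deg (omega m) (snd u) = l"
  proof (rule ex1I[of _ "((p, p + k), (p + k, q))"])
    show "fst ((p, p + k), (p + k, q)) \<in> paths (omega m) \<and> snd ((p, p + k), (p + k, q)) \<in> paths (omega m)
      \<and> src (omega m) (fst ((p, p + k), (p + k, q))) = rng (omega m) (snd ((p, p + k), (p + k, q)))
      \<and> a = cmp (omega m) (fst ((p, p + k), (p + k, q))) (snd ((p, p + k), (p + k, q)))
      \<and> deg (omega m) (fst ((p, p + k), (p + k, q))) = k
      \<and> deg (omega m) (snd ((p, p + k), (p + k, q))) = l"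
      using le m by (simp add: omega_def pq q le_fun_def fun_eq_iff)
  next
    fix u
    assume "fst u \<in> paths (omega m) \<and> snd u \<in> paths (omega m)
      \<and> src (omega m) (fst u) = rng (omega m) (snd u)
      \<and> a = cmp (omega m) (fst u) (snd u) \<and> deg (omega m) (fst u) = k \<and> deg (omega m) (snd u) = l"
    then obtain t where "u = ((p, t), (t, q))" "p \<le> t" "t - p = k"
      by (cases u) (auto simp: omega_def pq)
    then show "u = ((p, p + k), (p + k, q))" using split by simp
  qed
next
  fix a b :: "('k \<Rightarrow> nat) \<times> ('k \<Rightarrow> nat)"
  assume "a \<in> paths (omega m)" "b \<in> paths (omega m)" "src (omega m) a = rng (omega m) b"
  then show "deg (omega m) (cmp (omega m) a b) = deg (omega m) a + deg (omega m) b"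
    by (auto simp: omega_def le_fun_def fun_eq_iff)
qed (clarsimp simp: omega_def zero_fun_def, (blast intro: emb_mono order_trans)?)+

definition degree_functor :: "('b, 'k) hrgraph \<Rightarrow> ('a, 'k) hrgraph \<Rightarrow> ('b \<Rightarrow> 'a) \<Rightarrow> bool" where
  "degree_functor H G f \<longleftrightarrow>
     (\<forall>a\<in>paths H. f a \<in> paths G \<and> f (rng H a) = rng G (f a) \<and> f (src H a) = src G (f a)
                  \<and> deg G (f a) = deg H a)
   \<and> (\<forall>a\<in>paths H. \<forall>b\<in>paths H. src H a = rng H b \<longrightarrow> f (cmp H a b) = cmp G (f a) (f b))"

text \<open>
  The degree is stored next to the underlying map, and the map is required below to be
  \<open>undefined\<close> off its domain, so that HOL equality is equality of functors.
\<close>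

datatype ('a, 'k) gpath =
  GPath (pdeg: "'k \<Rightarrow> enat") (pmap: "('k \<Rightarrow> nat) \<times> ('k \<Rightarrow> nat) \<Rightarrow> 'a")

definition boundary_paths :: "('a, 'k) hrgraph \<Rightarrow> ('a, 'k) gpath set" where
  "boundary_paths G = {x. degree_functor (omega (pdeg x)) G (pmap x)
     \<and> pmap x \<in> extensional (paths (omega (pdeg x)))
     \<and> (\<forall>n E. emb n \<le> pdeg x \<longrightarrow> finite E \<longrightarrow> exhaustive G (pmap x (n, n)) E \<longrightarrow>
          (\<exists>a\<in>E. emb (n + deg G a) \<le> pdeg x \<and> pmap x (n, n + deg G a) = a))}"

definition prange :: "('a, 'k) gpath \<Rightarrow> 'a" where
  "prange x = pmap x (0, 0)"

definition shift :: "('k \<Rightarrow> nat) \<Rightarrow> ('a, 'k) gpath \<Rightarrow> ('a, 'k) gpath" where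
  "shift p x = GPath (pdeg x - emb p)
     (restrict (\<lambda>(a, b). pmap x (a + p, b + p)) (paths (omega (pdeg x - emb p))))"

definition prepend :: "('a, 'k) hrgraph \<Rightarrow> 'a \<Rightarrow> ('a, 'k) gpath \<Rightarrow> ('a, 'k) gpath" where
  "prepend G a x = (THE y. y \<in> boundary_paths G \<and> pdeg y = emb (deg G a) + pdeg x
     \<and> pmap y (0, deg G a) = a \<and> shift (deg G a) y = x)"

definition cyl :: "('a, 'k) hrgraph \<Rightarrow> 'a \<Rightarrow> ('a, 'k) gpath set" where
  "cyl G a = {y \<in> boundary_paths G. emb (deg G a) \<le> pdeg y \<and> pmap y (0, deg G a) = a}"

definition cyl_diff :: "('a, 'k) hrgraph \<Rightarrow> 'a \<Rightarrow> 'a set \<Rightarrow> ('a, 'k) gpath set" where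
  "cyl_diff G a F = cyl G a - (\<Union>b\<in>F. cyl G (cmp G a b))"

definition boundary_topology :: "('a, 'k) hrgraph \<Rightarrow> ('a, 'k) gpath topology" where
  "boundary_topology G = topology_generated_by
     {cyl_diff G a F | a F. a \<in> paths G \<and> finite F \<and> F \<subseteq> vpaths G (src G a)}"

lemma (in higher_rank_graph) topspace_boundary_topology:
  "topspace (boundary_topology G) = boundary_paths G"
proof
  show "topspace (boundary_topology G) \<subseteq> boundary_paths G"
    by (auto simp: boundary_topology_def cyl_diff_def cyl_def)
next
  show "boundary_paths G \<subseteq> topspace (boundary_topology G)"
  proof
    fix x assume x: "x \<in> boundary_paths G"
    let ?O = "omega (pdeg x)"
    have e: "emb 0 \<le> pdeg x"
      by (simp add: emb_def le_fun_def zero_enat_def[symmetric])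
    then have z: "(0, 0) \<in> paths ?O" by (simp add: omega_def)
    have "degree_functor ?O G (pmap x)" using x by (simp add: boundary_paths_def)
    then have p: "prange x \<in> paths G" and "deg G (prange x) = deg ?O (0, 0)"
      using z unfolding degree_functor_def prange_def by blast+
    then have d: "deg G (prange x) = 0" by (simp add: omega_def)
    have "x \<in> cyl_diff G (prange x) {}"
      using x d e by (simp add: cyl_diff_def cyl_def prange_def)
    moreover have "cyl_diff G (prange x) {} \<in>
        {cyl_diff G a F | a F. a \<in> paths G \<and> finite F \<and> F \<subseteq> vpaths G (src G a)}"
      using p by (intro CollectI exI[of _ "prange x"] exI[of _ "{}"]) simp
    ultimately show "x \<in> topspace (boundary_topology G)"
      unfolding boundary_topology_def topology_generated_by_topspace by (rule UnionI[rotated])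
  qed
qed

section \<open>Orbit spaces of topological groupoids\<close>

text \<open>
  The unit space is identified with a set of objects of type \<open>'u\<close>, namely
  \<open>topspace (unit_topology A)\<close>; range and source take values there, and
  \<open>gmult A g h\<close> is only meaningful if \<open>gsource A g = grange A h\<close>.
\<close>

record ('g, 'u) top_groupoid =
  grange :: "'g \<Rightarrow> 'u"
  gsource :: "'g \<Rightarrow> 'u"
  gmult :: "'g \<Rightarrow> 'g \<Rightarrow> 'g"
  ginv :: "'g \<Rightarrow> 'g"
  arrows :: "'g set"
  arrow_topology :: "'g topology"
  unit_topology :: "'u topology"

definition orbit :: "('g, 'u) top_groupoid \<Rightarrow> 'u \<Rightarrow> 'u set" where
  "orbit A x = {gsource A g | g. g \<in> arrows A \<and> grange A g = x}"

definition quotient_topology :: "'u topology \<Rightarrow> ('u \<Rightarrow> 'v) \<Rightarrow> 'v topology" where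
  "quotient_topology X f =
     topology (\<lambda>U. U \<subseteq> f ` topspace X \<and> openin X {x \<in> topspace X. f x \<in> U})"

lemma openin_quotient_topology:
  "openin (quotient_topology X f) U \<longleftrightarrow>
     U \<subseteq> f ` topspace X \<and> openin X {x \<in> topspace X. f x \<in> U}"
proof -
  let ?L = "\<lambda>U. U \<subseteq> f ` topspace X \<and> openin X {x \<in> topspace X. f x \<in> U}"
  have "istopology ?L"
    unfolding istopology_def
  proof (intro conjI allI impI)
    fix S T assume "?L S" "?L T"
    moreover have "{x \<in> topspace X. f x \<in> S \<inter> T}
        = {x \<in> topspace X. f x \<in> S} \<inter> {x \<in> topspace X. f x \<in> T}" by auto
    ultimately show "S \<inter> T \<subseteq> f ` topspace X" "openin X {x \<in> topspace X. f x \<in> S \<inter> T}"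
      by (auto intro: openin_Int)
  next
    fix \<K> assume K: "\<forall>K\<in>\<K>. ?L K"
    have "{x \<in> topspace X. f x \<in> \<Union>\<K>} = (\<Union>K\<in>\<K>. {x \<in> topspace X. f x \<in> K})" by auto
    with K show "openin X {x \<in> topspace X. f x \<in> \<Union>\<K>}" by auto
    from K show "\<Union>\<K> \<subseteq> f ` topspace X" by blast
  qed
  then show ?thesis by (simp add: quotient_topology_def)
qed

lemma topspace_quotient_topology: "topspace (quotient_topology X f) = f ` topspace X"
proof -
  have "{x \<in> topspace X. f x \<in> f ` topspace X} = topspace X" by auto
  then have "openin (quotient_topology X f) (f ` topspace X)"
    by (simp add: openin_quotient_topology)
  then show ?thesis
    by (meson openin_quotient_topology openin_subset openin_topspace subset_antisym)
qed

lemma quotient_map_quotient_topology: "quotient_map X (quotient_topology X f) f"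
  by (auto simp: quotient_map_def topspace_quotient_topology openin_quotient_topology)

definition orbit_space :: "('g, 'u) top_groupoid \<Rightarrow> 'u set topology" where
  "orbit_space A = quotient_topology (unit_topology A) (orbit A)"

section \<open>The boundary path groupoid\<close>

definition bpg_arrows ::
    "('a, 'k) hrgraph \<Rightarrow> (('a, 'k) gpath \<times> ('k \<Rightarrow> int) \<times> ('a, 'k) gpath) set" where
  "bpg_arrows G = {(x, m, y). x \<in> boundary_paths G \<and> y \<in> boundary_paths G
     \<and> (\<exists>p q. m = (int \<circ> p) - (int \<circ> q) \<and> emb p \<le> pdeg x \<and> emb q \<le> pdeg y \<and> shift p x = shift q y)}"

definition bpg_cyl ::
    "('a, 'k) hrgraph \<Rightarrow> 'a \<Rightarrow> 'a \<Rightarrow> (('a, 'k) gpath \<times> ('k \<Rightarrow> int) \<times> ('a, 'k) gpath) set" where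
  "bpg_cyl G a b = {(prepend G a z, (int \<circ> deg G a) - (int \<circ> deg G b), prepend G b z) | z.
     z \<in> boundary_paths G \<and> prange z = src G a}"

definition bpg_topology ::
    "('a, 'k) hrgraph \<Rightarrow> (('a, 'k) gpath \<times> ('k \<Rightarrow> int) \<times> ('a, 'k) gpath) topology" where
  "bpg_topology G = topology_generated_by
     {bpg_cyl G a b - (\<Union>c\<in>F. bpg_cyl G (cmp G a c) (cmp G b c)) | a b F.
        a \<in> paths G \<and> b \<in> paths G \<and> src G a = src G b \<and> finite F \<and> F \<subseteq> vpaths G (src G a)}"

definition boundary_path_groupoid ::
    "('a, 'k) hrgraph
      \<Rightarrow> (('a, 'k) gpath \<times> ('k \<Rightarrow> int) \<times> ('a, 'k) gpath, ('a, 'k) gpath) top_groupoid" where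
  "boundary_path_groupoid G = \<lparr>
     grange = (\<lambda>(x, m, y). x),
     gsource = (\<lambda>(x, m, y). y),
     gmult = (\<lambda>(x, m, y) (y', n, z). (x, m + n, z)),
     ginv = (\<lambda>(x, m, y). (y, - m, x)),
     arrows = bpg_arrows G,
     arrow_topology = bpg_topology G,
     unit_topology = boundary_topology G \<rparr>"

lemma orbit_boundary_path_groupoid:
  assumes "x \<in> boundary_paths G"
  shows "orbit (boundary_path_groupoid G) x = {y \<in> boundary_paths G.
    \<exists>p q. emb p \<le> pdeg x \<and> emb q \<le> pdeg y \<and> shift p x = shift q y}"
  using assms by (force simp: orbit_def boundary_path_groupoid_def bpg_arrows_def)

end

theory Submission
  imports Defs
begin

text \<open>
  Replacing an initial segment of a boundary path by another one with the same source is a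
  homeomorphism between basic open sets, so saturations of open sets are open, and the orbit space
  is \<open>T\<^sub>0\<close> iff orbits meeting the same open sets coincide.

  Suppose every path is isolated in its orbit, by a basic set \<open>U\<close> with \<open>U \<inter> O\<^sub>x = {x}\<close>, and
  \<open>O\<^sub>x\<close>, \<open>O\<^sub>y\<close> meet the same open sets. Then \<open>O\<^sub>y\<close> meets \<open>U\<close>, but not the open set \<open>U - {x}\<close>, so
  \<open>x \<in> O\<^sub>y\<close>.

  Conversely let the orbit space be \<open>T\<^sub>0\<close> and \<open>x\<close> not isolated in \<open>O\<^sub>x\<close>; then \<open>O\<^sub>x\<close> is countable
  and, by homogeneity, has no isolated point. A Baire category argument in the closure of \<open>O\<^sub>x\<close>
  produces a boundary path \<open>w\<close> there that avoids every point of \<open>O\<^sub>x\<close> and lies in the saturation of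
  every basic set that meets \<open>O\<^sub>x\<close>. Hence \<open>O\<^sub>w\<close> and \<open>O\<^sub>x\<close> meet the same open sets although
  \<open>w \<notin> O\<^sub>x\<close>. Instead of local compactness, the Baire argument uses shrinking sets that decide, for
  each path \<open>b\<close> in turn, whether the limit lies in \<open>Z(b)\<close>.
\<close>

section \<open>Arithmetic of degrees with infinite entries\<close>

lemma emb_zero_le [simp]: "emb 0 \<le> m"
  by (simp add: emb_def le_fun_def zero_enat_def[symmetric])

lemma emb_sup_le_iff: "emb (sup a b) \<le> m \<longleftrightarrow> emb a \<le> m \<and> emb b \<le> m"
proof -
  have "enat (sup (a i) (b i)) \<le> m i \<longleftrightarrow> enat (a i) \<le> m i \<and> enat (b i) \<le> m i" for i
    by (cases "m i") auto
  then show ?thesis by (auto simp: emb_def le_fun_def)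
qed

lemma emb_le_diff_iff:
  assumes "emb p \<le> m"
  shows "emb n \<le> m - emb p \<longleftrightarrow> emb (n + p) \<le> m"
proof -
  have "enat (n i) \<le> m i - enat (p i) \<longleftrightarrow> enat (n i + p i) \<le> m i" for i
    using assms by (cases "m i") (auto simp: emb_def le_fun_def dest!: spec[of _ i])
  then show ?thesis by (simp add: emb_def le_fun_def)
qed

lemma diff_emb_diff_emb:
  fixes m :: "'k \<Rightarrow> enat"
  shows "m - emb p - emb r = m - emb (r + p)"
proof
  fix i show "(m - emb p - emb r) i = (m - emb (r + p)) i"
    by (cases "m i") (simp_all add: emb_def)
qed

lemma emb_add_diff:
  fixes m :: "'k \<Rightarrow> enat"
  shows "emb p + m - emb p = m"
proof
  fix i show "(emb p + m - emb p) i = m i"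
    by (cases "m i") (simp_all add: emb_def)
qed

text \<open>An extended natural is determined by the naturals below it. Tuples supported at one
  coordinate isolate each entry, so finite tuples suffice to detect even the infinite ones.\<close>

lemma enat_tuple_eqI:
  assumes "\<And>n. emb n \<le> m \<longleftrightarrow> emb n \<le> m'"
  shows "m = m'"
proof
  fix i
  have eq: "enat t \<le> m i \<longleftrightarrow> enat t \<le> m' i" for t
  proof -
    have "emb (\<lambda>j. if j = i then t else 0) \<le> u \<longleftrightarrow> enat t \<le> u i" for u
      by (auto simp: emb_def le_fun_def zero_enat_def[symmetric])
    then show ?thesis using assms by blast
  qed
  have "a \<le> b" if "\<And>t. enat t \<le> a \<Longrightarrow> enat t \<le> b" for a b :: enat
    using that by (cases a; cases b) (auto intro: ccontr dest: not_le_imp_less, metis Suc_n_not_le_n)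
  then show "m i = m' i" using eq by (metis antisym)
qed

lemma tuple_le_add_diff: "a \<le> b \<Longrightarrow> a + (b - a) = b" for a b :: "'k \<Rightarrow> nat"
  by (auto simp: fun_eq_iff le_fun_def)

section \<open>Prefixes and common extensions\<close>

context higher_rank_graph
begin

text \<open>Uniqueness in the factorization property. Equal degrees of the first factors force equal
  degrees of the second ones, so both pairs factor the same path with the same degrees.\<close>

lemma cmp_eq_cmpD:
  assumes "a \<in> paths G" "b \<in> paths G" "a' \<in> paths G" "b' \<in> paths G"
    and "src G a = rng G b" "src G a' = rng G b'"
    and "cmp G a b = cmp G a' b'" "deg G a = deg G a'"
  shows "a = a'" "b = b'"
proof -
  let ?c = "cmp G a b"
  have d: "deg G ?c = deg G a + deg G b" "deg G ?c = deg G a' + deg G b'"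
    using deg_cmp assms by metis+
  with assms(8) have db: "deg G b = deg G b'" by simp
  have "\<exists>!p. fst p \<in> paths G \<and> snd p \<in> paths G \<and> src G (fst p) = rng G (snd p)
     \<and> ?c = cmp G (fst p) (snd p) \<and> deg G (fst p) = deg G a \<and> deg G (snd p) = deg G b"
    by (rule factorization) (use assms cmp_in d in auto)
  then have "(a, b) = (a', b')"
    using assms db by (metis fst_conv snd_conv)
  then show "a = a'" "b = b'" by auto
qed

lemma cmp_left_cancel:
  assumes "a \<in> paths G" "b \<in> paths G" "b' \<in> paths G" "src G a = rng G b" "src G a = rng G b'"
    and "cmp G a b = cmp G a b'"
  shows "b = b'"
  using cmp_eq_cmpD(2)[of a b a b'] assms by blast

lemma factorE:
  assumes "c \<in> paths G" "n \<le> deg G c"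
  obtains a b where "a \<in> paths G" "b \<in> paths G" "src G a = rng G b" "c = cmp G a b"
    "deg G a = n" "deg G b = deg G c - n"
proof -
  have "deg G c = n + (deg G c - n)" using assms by (simp add: tuple_le_add_diff)
  from factorization[OF assms(1) this] that show ?thesis by (metis (no_types))
qed

section \<open>The order by initial segments\<close>

definition prefix :: "'a \<Rightarrow> 'a \<Rightarrow> bool" where
  "prefix a c \<longleftrightarrow> a \<in> paths G \<and> (\<exists>b\<in>paths G. src G a = rng G b \<and> c = cmp G a b)"

lemma prefixI: "a \<in> paths G \<Longrightarrow> b \<in> paths G \<Longrightarrow> src G a = rng G b \<Longrightarrow> prefix a (cmp G a b)"
  by (auto simp: prefix_def)

lemma prefix_in: "prefix a c \<Longrightarrow> a \<in> paths G \<and> c \<in> paths G"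
  by (auto simp: prefix_def cmp_in)

lemma prefix_trans:
  assumes "prefix a b" "prefix b c"
  shows "prefix a c"
proof -
  obtain d e where "a \<in> paths G" "d \<in> paths G" "src G a = rng G d" "b = cmp G a d"
    "e \<in> paths G" "src G b = rng G e" "c = cmp G b e" using assms by (auto simp: prefix_def)
  then have "c = cmp G a (cmp G d e)" "cmp G d e \<in> paths G" "src G a = rng G (cmp G d e)"
    by (auto simp: cmp_assoc src_cmp cmp_in rng_cmp)
  then show ?thesis using \<open>a \<in> paths G\<close> by (auto simp: prefix_def)
qed

lemma prefix_same_deg: "prefix a c \<Longrightarrow> prefix b c \<Longrightarrow> deg G a = deg G b \<Longrightarrow> a = b"
  using cmp_eq_cmpD(1) unfolding prefix_def by metis

text \<open>Cut \<open>b\<close> at degree \<open>deg G a\<close>. The piece is a prefix of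
  \<open>c\<close> of the same degree as \<open>a\<close>, hence equal to \<open>a\<close>.\<close>

lemma prefix_of_prefixes:
  assumes "prefix a c" "prefix b c" "deg G a \<le> deg G b"
  shows "prefix a b"
proof -
  obtain a' e where a': "a' \<in> paths G" "e \<in> paths G" "src G a' = rng G e" "b = cmp G a' e"
    "deg G a' = deg G a" using factorE[of b "deg G a"] assms prefix_in by metis
  then have "prefix a' b" by (simp add: prefixI)
  moreover from this have "a = a'"
    using prefix_same_deg prefix_trans assms(1,2) a'(5) by metis
  ultimately show ?thesis by simp
qed

lemma prefix_cmp_cmp_iff:
  assumes "a \<in> paths G" "b \<in> paths G" "c \<in> paths G" "src G a = rng G b" "src G a = rng G c"
  shows "prefix (cmp G a b) (cmp G a c) \<longleftrightarrow> prefix b c"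
proof
  assume "prefix (cmp G a b) (cmp G a c)"
  then obtain d where d: "d \<in> paths G" "src G b = rng G d" "cmp G a c = cmp G a (cmp G b d)"
    using assms by (auto simp: prefix_def src_cmp cmp_assoc)
  then have "c = cmp G b d"
    using cmp_left_cancel[of a c "cmp G b d"] assms by (simp add: cmp_in rng_cmp)
  then show "prefix b c" using d assms by (auto simp: prefix_def)
next
  assume "prefix b c"
  then obtain d where "d \<in> paths G" "src G b = rng G d" "c = cmp G b d"
    by (auto simp: prefix_def)
  then show "prefix (cmp G a b) (cmp G a c)"
    using assms by (auto simp: prefix_def cmp_in src_cmp cmp_assoc intro!: bexI[of _ d])
qed

lemma deg_prefix_le: "prefix a c \<Longrightarrow> deg G a \<le> deg G c"
  by (auto simp: prefix_def deg_cmp le_fun_def)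

text \<open>Cut \<open>c\<close> at the join of the two degrees: \<open>a\<close> and
  \<open>b\<close> are both prefixes of that piece, which is therefore a minimal common
  extension.\<close>

lemma min_ext_of_common_extension:
  assumes "prefix a c" "prefix b c"
  obtains p t where "(p, t) \<in> min_ext G a b" "prefix (cmp G a p) c"
proof -
  have "sup (deg G a) (deg G b) \<le> deg G c" using assms deg_prefix_le by simp
  then obtain u where u: "prefix u c" "deg G u = sup (deg G a) (deg G b)"
    using factorE[of c "sup (deg G a) (deg G b)"] assms prefix_in prefixI by metis
  have "prefix a u" "prefix b u"
    using prefix_of_prefixes assms u by (metis sup.cobounded1 sup.cobounded2)+
  then show ?thesis using that u unfolding prefix_def min_ext_def by fastforce
qed

lemma min_extD:
  assumes "(p, t) \<in> min_ext G a b"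
  shows "p \<in> paths G" "t \<in> paths G" "src G a = rng G p" "src G b = rng G t"
    "cmp G a p = cmp G b t" "deg G (cmp G a p) = sup (deg G a) (deg G b)"
  using assms by (auto simp: min_ext_def)

lemma vpaths_iff: "a \<in> vpaths G v \<longleftrightarrow> a \<in> paths G \<and> rng G a = v"
  by (auto simp: vpaths_def)

text \<open>The paper's \<open>Ext\<close>: the paths extending \<open>a\<close> minimally to a common extension with \<open>E\<close>.\<close>

definition ext :: "'a \<Rightarrow> 'a set \<Rightarrow> 'a set" where
  "ext a E = (\<Union>b\<in>E. fst ` min_ext G a b)"

lemma finite_ext:
  assumes "finitely_aligned G" "a \<in> paths G" "E \<subseteq> paths G" "finite E"
  shows "finite (ext a E)"
  using assms by (auto simp: ext_def finitely_aligned_def subset_iff)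

lemma ext_subset: "ext a E \<subseteq> vpaths G (src G a)"
  by (auto simp: ext_def vpaths_def min_ext_def)

text \<open>For \<open>c\<close> starting at the source of \<open>a\<close>, exhaustiveness gives
  \<open>cmp G a c\<close> a common extension \<open>?u\<close> with some \<open>e\<close> in
  \<open>E\<close>. As \<open>?u\<close> extends both \<open>a\<close> and \<open>e\<close>, it
  contains a minimal common extension \<open>cmp G a q\<close> of them; cancelling \<open>a\<close>
  leaves a common extension of \<open>q\<close> and \<open>c\<close>.\<close>

lemma exhaustive_ext:
  assumes "a \<in> paths G" "exhaustive G (rng G a) E"
  shows "exhaustive G (src G a) (ext a E)"
  unfolding exhaustive_def
proof (intro conjI ballI ext_subset)
  fix c assume "c \<in> vpaths G (src G a)"
  then have c: "c \<in> paths G" "src G a = rng G c" by (auto simp: vpaths_iff)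
  then have "cmp G a c \<in> vpaths G (rng G a)" using assms by (simp add: vpaths_iff cmp_in rng_cmp)
  then obtain e p t where e: "e \<in> E" "e \<in> paths G" and "(p, t) \<in> min_ext G e (cmp G a c)"
    using assms(2) unfolding exhaustive_def by (fastforce simp: vpaths_iff)
  note pt = min_extD[OF this(3)]
  let ?ct = "cmp G c t" and ?u = "cmp G a (cmp G c t)"
  have u: "?u = cmp G e p" "?ct \<in> paths G" "src G a = rng G ?ct" "src G c = rng G t"
    using pt c assms by (auto simp: cmp_assoc src_cmp cmp_in rng_cmp)
  have "prefix a ?u" "prefix e ?u"
    using prefixI[of a ?ct] prefixI[of e p] u pt e assms by metis+
  then obtain q s where "(q, s) \<in> min_ext G a e" and pre: "prefix (cmp G a q) ?u"
    by (rule min_ext_of_common_extension)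
  then have q: "q \<in> ext a E" "q \<in> paths G" "src G a = rng G q"
    using e by (auto simp: ext_def min_ext_def image_iff intro!: bexI[of _ e])
  then have "prefix q ?ct" using pre prefix_cmp_cmp_iff assms u by blast
  moreover have "prefix c ?ct" using c pt u by (simp add: prefixI)
  ultimately have "min_ext G q c \<noteq> {}" using min_ext_of_common_extension by blast
  then show "\<exists>q\<in>ext a E. min_ext G q c \<noteq> {}" using q by blast
qed

section \<open>Segments, shifts and cylinders of boundary paths\<close>

text \<open>Paths without the boundary condition. Limits and prepended paths are first built as such
  functors, and the condition on exhaustive sets is verified afterwards.\<close>

definition functor_path :: "('a, 'k) gpath \<Rightarrow> bool" where
  "functor_path x \<longleftrightarrow> degree_functor (omega (pdeg x)) G (pmap x)
     \<and> pmap x \<in> extensional (paths (omega (pdeg x)))"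

lemma functor_path_iff:
  "functor_path x \<longleftrightarrow>
     (\<forall>a b. a \<le> b \<longrightarrow> emb b \<le> pdeg x \<longrightarrow> pmap x (a, b) \<in> paths G
        \<and> rng G (pmap x (a, b)) = pmap x (a, a) \<and> src G (pmap x (a, b)) = pmap x (b, b)
        \<and> deg G (pmap x (a, b)) = b - a)
   \<and> (\<forall>a b c. a \<le> b \<longrightarrow> b \<le> c \<longrightarrow> emb c \<le> pdeg x
        \<longrightarrow> pmap x (a, c) = cmp G (pmap x (a, b)) (pmap x (b, c)))
   \<and> (\<forall>a b. \<not> (a \<le> b \<and> emb b \<le> pdeg x) \<longrightarrow> pmap x (a, b) = undefined)"
proof -
  let ?O = "omega (pdeg x)"
  have E: "(\<forall>a b. \<not> (a \<le> b \<and> emb b \<le> pdeg x) \<longrightarrow> pmap x (a, b) = undefined) \<longleftrightarrow>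
      pmap x \<in> extensional (paths ?O)"
    by (auto simp: extensional_def omega_def)
  have D: "(\<forall>a\<in>paths ?O. pmap x a \<in> paths G \<and> pmap x (rng ?O a) = rng G (pmap x a)
        \<and> pmap x (src ?O a) = src G (pmap x a) \<and> deg G (pmap x a) = deg ?O a) \<longleftrightarrow>
      (\<forall>a b. a \<le> b \<longrightarrow> emb b \<le> pdeg x \<longrightarrow> pmap x (a, b) \<in> paths G
        \<and> rng G (pmap x (a, b)) = pmap x (a, a) \<and> src G (pmap x (a, b)) = pmap x (b, b)
        \<and> deg G (pmap x (a, b)) = b - a)"
    by (auto simp: omega_def)
  have C: "(\<forall>a\<in>paths ?O. \<forall>b\<in>paths ?O. src ?O a = rng ?O b \<longrightarrow>
        pmap x (cmp ?O a b) = cmp G (pmap x a) (pmap x b)) \<longleftrightarrow>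
      (\<forall>a b c. a \<le> b \<longrightarrow> b \<le> c \<longrightarrow> emb c \<le> pdeg x
        \<longrightarrow> pmap x (a, c) = cmp G (pmap x (a, b)) (pmap x (b, c)))" (is "?L \<longleftrightarrow> ?R")
  proof
    assume L: ?L
    show ?R
    proof (intro allI impI)
      fix a b c assume "a \<le> b" "b \<le> c" "emb c \<le> pdeg x"
      then have "(a, b) \<in> paths ?O" "(b, c) \<in> paths ?O"
        using emb_mono by (auto simp: omega_def)
      from L[rule_format, OF this]
      show "pmap x (a, c) = cmp G (pmap x (a, b)) (pmap x (b, c))" by (simp add: omega_def)
    qed
  next
    assume R: ?R
    show ?L
    proof (intro ballI impI)
      fix u v assume "u \<in> paths ?O" "v \<in> paths ?O" "src ?O u = rng ?O v"
      then obtain a b c where "u = (a, b)" "v = (b, c)" "a \<le> b" "b \<le> c" "emb c \<le> pdeg x"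
        by (auto simp: omega_def)
      then show "pmap x (cmp ?O u v) = cmp G (pmap x u) (pmap x v)"
        using R[rule_format, of a b c] by (simp add: omega_def)
    qed
  qed
  show ?thesis
    unfolding functor_path_def degree_functor_def D C E by (simp only: conj_assoc)
qed

lemma segment:
  assumes "functor_path x" "a \<le> b" "emb b \<le> pdeg x"
  shows "pmap x (a, b) \<in> paths G" "rng G (pmap x (a, b)) = pmap x (a, a)"
    "src G (pmap x (a, b)) = pmap x (b, b)" "deg G (pmap x (a, b)) = b - a"
  using assms unfolding functor_path_iff by blast+

lemma segment_cmp:
  assumes "functor_path x" "a \<le> b" "b \<le> c" "emb c \<le> pdeg x"
  shows "pmap x (a, c) = cmp G (pmap x (a, b)) (pmap x (b, c))"
  using assms unfolding functor_path_iff by blast+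

lemma initial:
  assumes "functor_path x" "emb b \<le> pdeg x"
  shows "pmap x (0, b) \<in> paths G" "rng G (pmap x (0, b)) = prange x"
    "src G (pmap x (0, b)) = pmap x (b, b)" "deg G (pmap x (0, b)) = b"
  using segment[OF assms(1) _ assms(2), of 0] by (auto simp: prange_def le_fun_def)

lemma prefix_initial:
  assumes "functor_path x" "a \<le> b" "emb b \<le> pdeg x"
  shows "prefix (pmap x (0, a)) (pmap x (0, b))"
proof -
  have "emb a \<le> pdeg x" using assms emb_mono by blast
  then have "pmap x (0, b) = cmp G (pmap x (0, a)) (pmap x (a, b))"
    using segment_cmp[of x 0 a b] assms by (simp add: le_fun_def)
  then show ?thesis
    using prefixI[of "pmap x (0, a)" "pmap x (a, b)"] assms initial[of x a] segment[of x a b]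
      \<open>emb a \<le> pdeg x\<close> by simp
qed

text \<open>The segment from \<open>a\<close> to \<open>b\<close> is what remains of the initial
  segment of degree \<open>b\<close> after cancelling that of degree \<open>a\<close>. Off the
  domain both maps take the default value.\<close>

lemma functor_path_eqI:
  assumes "functor_path x" "functor_path y" "pdeg x = pdeg y"
    and "\<And>n. emb n \<le> pdeg x \<Longrightarrow> pmap x (0, n) = pmap y (0, n)"
  shows "x = y"
proof -
  have "pmap x (a, b) = pmap y (a, b)" for a b
  proof (cases "a \<le> b \<and> emb b \<le> pdeg x")
    case True
    then have a: "emb a \<le> pdeg x" using emb_mono by blast
    have "cmp G (pmap x (0, a)) (pmap x (a, b)) = cmp G (pmap x (0, a)) (pmap y (a, b))"
      using segment_cmp[OF assms(1), of 0 a b] segment_cmp[OF assms(2), of 0 a b] True a assms(3,4)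
      by (simp add: le_fun_def)
    moreover have "src G (pmap x (0, a)) = rng G (pmap x (a, b))"
      "src G (pmap x (0, a)) = rng G (pmap y (a, b))"
      using initial(3)[OF assms(1) a] initial(3)[OF assms(2), of a] segment(2)[OF assms(1)]
        segment(2)[OF assms(2)] a assms(3,4) True by auto
    ultimately show ?thesis
      using cmp_left_cancel initial(1)[OF assms(1) a] segment(1) assms(1-3) True by metis
  next
    case False
    then show ?thesis using assms unfolding functor_path_iff by metis
  qed
  then have "pmap x = pmap y" by auto
  with assms(3) show ?thesis by (cases x; cases y) simp
qed

text \<open>Coherent initial segments, one in each degree, extend to a functor: its value at
  \<open>(a, b)\<close> is the quotient of \<open>f b\<close> by \<open>f a\<close>, and
  functoriality follows because left cancellation makes quotients unique.\<close>

lemma functor_path_of_initials: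
  assumes f: "\<And>n. emb n \<le> m \<Longrightarrow> f n \<in> paths G \<and> deg G (f n) = n"
    and pre: "\<And>a b. a \<le> b \<Longrightarrow> emb b \<le> m \<Longrightarrow> prefix (f a) (f b)"
  obtains x where "functor_path x" "pdeg x = m" "\<And>n. emb n \<le> m \<Longrightarrow> pmap x (0, n) = f n"
proof -
  define P where "P a b c \<longleftrightarrow> c \<in> paths G \<and> src G (f a) = rng G c \<and> f b = cmp G (f a) c" for a b c
  define h where "h = (\<lambda>(a, b). if a \<le> b \<and> emb b \<le> m then SOME c. P a b c else undefined)"
  have hP: "P a b (h (a, b))" if "a \<le> b" "emb b \<le> m" for a b
  proof -
    have "\<exists>c. P a b c" using pre[OF that] by (auto simp: prefix_def P_def)
    then show ?thesis using that by (auto simp: h_def intro: someI_ex)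
  qed
  have uniq: "c = h (a, b)" if "P a b c" "a \<le> b" "emb b \<le> m" for a b c
    using cmp_left_cancel[of "f a" c "h (a, b)"] hP[OF that(2,3)] that f[of a] emb_mono[OF that(2,3)]
    unfolding P_def by metis
  \<comment> \<open>The quotient of \<open>f a\<close> by itself is the identity at its
    source.\<close>
  have id: "h (a, a) = src G (f a)" if "emb a \<le> m" for a
    using uniq[of a a "src G (f a)"] f[OF that] that
    by (auto simp: P_def src_in rng_src cmp_src_right)
  have hsrc: "src G (h (a, b)) = src G (f b)" and hdeg: "deg G (h (a, b)) = b - a"
    if "a \<le> b" "emb b \<le> m" for a b
  proof -
    note H = hP[OF that, unfolded P_def]
    have fa: "f a \<in> paths G" "deg G (f a) = a" using f emb_mono[OF that] by auto
    show "src G (h (a, b)) = src G (f b)" using H fa by (metis src_cmp)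
    have "b = a + deg G (h (a, b))" using H fa f[OF that(2)] by (metis deg_cmp)
    then show "deg G (h (a, b)) = b - a" by (metis add_diff_cancel_left')
  qed
  have comp: "h (a, c) = cmp G (h (a, b)) (h (b, c))" if "a \<le> b" "b \<le> c" "emb c \<le> m" for a b c
  proof -
    have b: "emb b \<le> m" using that emb_mono by blast
    have a: "emb a \<le> m" using that b emb_mono by blast
    note H = hP[OF that(1) b, unfolded P_def] hP[OF that(2,3), unfolded P_def]
    have "src G (h (a, b)) = rng G (h (b, c))" using hsrc[OF that(1) b] H by simp
    then have "P a c (cmp G (h (a, b)) (h (b, c)))"
      using H f[OF a] by (auto simp: P_def cmp_in rng_cmp cmp_assoc)
    then show ?thesis using uniq that by (metis order_trans)
  qed
  have "functor_path (GPath m h)"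
    unfolding functor_path_iff
  proof (intro conjI allI impI; simp)
    fix a b :: "'k \<Rightarrow> nat" assume ab: "a \<le> b" "emb b \<le> m"
    note H = hP[OF ab, unfolded P_def]
    show "h (a, b) \<in> paths G" using H by simp
    show "rng G (h (a, b)) = h (a, a)" using H id emb_mono[OF ab] by simp
    show "src G (h (a, b)) = h (b, b)" using hsrc id ab by simp
    show "deg G (h (a, b)) = b - a" using hdeg ab by simp
  next
    fix a b c :: "'k \<Rightarrow> nat" assume "a \<le> b" "b \<le> c" "emb c \<le> m"
    then show "h (a, c) = cmp G (h (a, b)) (h (b, c))" by (rule comp)
  next
    fix a b :: "'k \<Rightarrow> nat" assume "a \<le> b \<longrightarrow> \<not> emb b \<le> m"
    then show "h (a, b) = undefined" by (auto simp: h_def)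
  qed
  moreover have "h (0, n) = f n" if n: "emb n \<le> m" for n
  proof -
    \<comment> \<open>Having degree zero, \<open>f 0\<close> is an identity, so the quotient of
      \<open>f n\<close> by it is \<open>f n\<close> itself.\<close>
    have f0: "f 0 \<in> paths G" "deg G (f 0) = 0" using f by auto
    then have "rng G (f 0) = f 0" using deg_zero_iff_identity by simp
    then have "src G (f 0) = f 0" using src_rng f0 by metis
    moreover have "0 \<le> n" by (simp add: le_fun_def)
    note H = hP[OF this n, unfolded P_def]
    ultimately show ?thesis using cmp_rng_left[of "h (0, n)"] H by auto
  qed
  ultimately show ?thesis using that[of "GPath m h"] by simp
qed

section \<open>Shifts\<close>

lemma pdeg_shift [simp]: "pdeg (shift p x) = pdeg x - emb p"
  by (simp add: shift_def)

lemma pmap_shift: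
  assumes "emb p \<le> pdeg x" "a \<le> b" "emb (b + p) \<le> pdeg x"
  shows "pmap (shift p x) (a, b) = pmap x (a + p, b + p)"
  using assms by (simp add: shift_def omega_def emb_le_diff_iff)

lemma functor_path_shift:
  assumes "functor_path x" "emb p \<le> pdeg x"
  shows "functor_path (shift p x)"
proof -
  have mono: "a + p \<le> b + p" if "a \<le> b" for a b :: "'k \<Rightarrow> nat" using that by (simp add: le_fun_def)
  have le: "emb (a + p) \<le> pdeg x" if "a \<le> b" "emb (b + p) \<le> pdeg x" for a b
    using emb_mono[OF mono] that by blast
  show ?thesis
    unfolding functor_path_iff
  proof (intro conjI allI impI)
    fix a b assume "a \<le> b" "emb b \<le> pdeg (shift p x)"
    then have ab: "a \<le> b" "emb (b + p) \<le> pdeg x" using assms by (auto simp: emb_le_diff_iff)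
    note S = segment[OF assms(1) mono[OF ab(1)] ab(2)]
    show "pmap (shift p x) (a, b) \<in> paths G" "rng G (pmap (shift p x) (a, b)) = pmap (shift p x) (a, a)"
      "src G (pmap (shift p x) (a, b)) = pmap (shift p x) (b, b)"
      "deg G (pmap (shift p x) (a, b)) = b - a"
      using S ab le[OF ab] assms by (simp_all add: pmap_shift)
  next
    fix a b c assume "a \<le> b" "b \<le> c" "emb c \<le> pdeg (shift p x)"
    then have "a \<le> b" "b \<le> c" "emb (c + p) \<le> pdeg x"
      using assms(2) by (simp_all add: emb_le_diff_iff)
    moreover from this have "a \<le> c" "emb (b + p) \<le> pdeg x"
      using le order_trans by blast+
    ultimately have abc: "a \<le> b" "b \<le> c" "emb (c + p) \<le> pdeg x" "a \<le> c" "emb (b + p) \<le> pdeg x"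
      by simp_all
    have "pmap x (a + p, c + p) = cmp G (pmap x (a + p, b + p)) (pmap x (b + p, c + p))"
      by (rule segment_cmp[OF assms(1) mono[OF abc(1)] mono[OF abc(2)] abc(3)])
    then show "pmap (shift p x) (a, c) = cmp G (pmap (shift p x) (a, b)) (pmap (shift p x) (b, c))"
      by (simp only: pmap_shift[OF assms(2)] abc)
  next
    fix a b assume "\<not> (a \<le> b \<and> emb b \<le> pdeg (shift p x))"
    then show "pmap (shift p x) (a, b) = undefined" by (auto simp: shift_def omega_def)
  qed
qed

lemma shift_shift:
  assumes "emb (r + p) \<le> pdeg x"
  shows "shift r (shift p x) = shift (r + p) x"
proof -
  have p: "emb p \<le> pdeg x" using emb_mono[of p "r + p"] assms by (simp add: le_fun_def)
  have r: "emb r \<le> pdeg x - emb p" using assms p by (simp add: emb_le_diff_iff)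
  have "pmap (shift r (shift p x)) (a, b) = pmap (shift (r + p) x) (a, b)" for a b
  proof (cases "a \<le> b \<and> emb (b + r + p) \<le> pdeg x")
    case True
    moreover from True have "a + r \<le> b + r" by (simp add: le_fun_def)
    moreover from True have "emb (b + r) \<le> pdeg x - emb p" using p by (simp add: emb_le_diff_iff)
    ultimately show ?thesis
      using p r assms by (simp add: pmap_shift emb_le_diff_iff ac_simps)
  next
    case False
    then have "(a, b) \<notin> paths (omega (pdeg x - emb (r + p)))"
      using assms by (auto simp: omega_def emb_le_diff_iff ac_simps)
    then show ?thesis by (simp add: shift_def diff_emb_diff_emb)
  qed
  then have "pmap (shift r (shift p x)) = pmap (shift (r + p) x)" by auto
  moreover have "pdeg (shift r (shift p x)) = pdeg (shift (r + p) x)"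
    by (simp add: diff_emb_diff_emb)
  ultimately show ?thesis by (metis gpath.expand)
qed

section \<open>The boundary condition under shifts\<close>

lemma boundary_paths_iff:
  "x \<in> boundary_paths G \<longleftrightarrow> functor_path x \<and>
     (\<forall>n E. emb n \<le> pdeg x \<longrightarrow> finite E \<longrightarrow> exhaustive G (pmap x (n, n)) E \<longrightarrow>
          (\<exists>a\<in>E. emb (n + deg G a) \<le> pdeg x \<and> pmap x (n, n + deg G a) = a))"
  by (auto simp: boundary_paths_def functor_path_def)

lemma boundary_functor_path: "x \<in> boundary_paths G \<Longrightarrow> functor_path x"
  by (simp add: boundary_paths_iff)

text \<open>The boundary condition of the shift at \<open>n\<close> is the boundary condition of
  \<open>x\<close> at \<open>n + p\<close>.\<close>

lemma boundary_shift:
  assumes "x \<in> boundary_paths G" "emb p \<le> pdeg x"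
  shows "shift p x \<in> boundary_paths G"
  unfolding boundary_paths_iff
proof (intro conjI allI impI)
  show "functor_path (shift p x)" using assms by (simp add: functor_path_shift boundary_functor_path)
next
  fix n E assume "emb n \<le> pdeg (shift p x)" and E: "finite E" "exhaustive G (pmap (shift p x) (n, n)) E"
  then have n: "emb (n + p) \<le> pdeg x" using assms by (simp add: emb_le_diff_iff)
  then have "exhaustive G (pmap x (n + p, n + p)) E" using E assms by (simp add: pmap_shift)
  then obtain a where a: "a \<in> E" "emb (n + p + deg G a) \<le> pdeg x"
    "pmap x (n + p, n + p + deg G a) = a"
    using assms(1) E(1) n unfolding boundary_paths_iff by blast
  then have "emb (n + deg G a + p) \<le> pdeg x" "pmap x (n + p, n + deg G a + p) = a"
    by (simp_all add: ac_simps)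
  moreover have "n \<le> n + deg G a" by (simp add: le_fun_def)
  ultimately have "emb (n + deg G a) \<le> pdeg (shift p x) \<and> pmap (shift p x) (n, n + deg G a) = a"
    using assms(2) by (simp add: emb_le_diff_iff pmap_shift)
  then show "\<exists>a\<in>E. emb (n + deg G a) \<le> pdeg (shift p x) \<and> pmap (shift p x) (n, n + deg G a) = a"
    using a(1) by blast
qed

section \<open>Cylinders\<close>

lemma cyl_iff:
  "y \<in> cyl G a \<longleftrightarrow> y \<in> boundary_paths G \<and> emb (deg G a) \<le> pdeg y \<and> pmap y (0, deg G a) = a"
  by (auto simp: cyl_def)

lemma cyl_in_paths: "y \<in> cyl G a \<Longrightarrow> a \<in> paths G"
  using initial(1)[OF boundary_functor_path, of y "deg G a"] by (auto simp: cyl_iff)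

lemma in_cyl_initial:
  "y \<in> boundary_paths G \<Longrightarrow> emb n \<le> pdeg y \<Longrightarrow> y \<in> cyl G (pmap y (0, n))"
  using initial(4)[OF boundary_functor_path, of y n] by (simp add: cyl_iff)

lemma in_cyl_prange: "y \<in> boundary_paths G \<Longrightarrow> y \<in> cyl G (prange y)"
  using in_cyl_initial[of y 0] by (simp add: prange_def)

lemma cyl_rng: "y \<in> cyl G a \<Longrightarrow> rng G a = prange y"
  using initial(2)[OF boundary_functor_path, of y "deg G a"] by (auto simp: cyl_iff)

lemma cyl_comparable:
  assumes "y \<in> cyl G a" "y \<in> cyl G b" "deg G a \<le> deg G b"
  shows "prefix a b"
  using prefix_initial[OF boundary_functor_path, of y "deg G a" "deg G b"] assms by (auto simp: cyl_iff)

lemma cyl_antimono: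
  assumes "prefix a b"
  shows "cyl G b \<subseteq> cyl G a"
proof
  fix y assume y: "y \<in> cyl G b"
  have le: "deg G a \<le> deg G b" using assms by (rule deg_prefix_le)
  then have e: "emb (deg G a) \<le> pdeg y" using y emb_mono by (auto simp: cyl_iff)
  let ?a = "pmap y (0, deg G a)"
  have f: "functor_path y" using y by (auto simp: cyl_iff boundary_functor_path)
  have "prefix ?a b"
    using prefix_initial[OF f le] y by (auto simp: cyl_iff)
  then have "?a = a" using prefix_same_deg assms initial(4)[OF f e] by blast
  then show "y \<in> cyl G a" using y e by (auto simp: cyl_iff)
qed

text \<open>An initial segment can be read in two stages: after \<open>a\<close>, left cancellation
  shows that \<open>cmp G a b\<close> is reached exactly when the next segment of degree
  \<open>deg G b\<close> is \<open>b\<close>. This moves cylinder conditions between a path and its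
  shifts.\<close>

lemma cyl_cmp_iff:
  assumes "a \<in> paths G" "b \<in> paths G" "src G a = rng G b"
  shows "y \<in> cyl G (cmp G a b) \<longleftrightarrow> y \<in> cyl G a \<and> shift (deg G a) y \<in> cyl G b"
proof -
  have sub: "cyl G (cmp G a b) \<subseteq> cyl G a" using assms by (intro cyl_antimono prefixI)
  have "y \<in> cyl G (cmp G a b) \<longleftrightarrow> shift (deg G a) y \<in> cyl G b" if y: "y \<in> cyl G a"
  proof -
    let ?m = "deg G a" and ?n = "deg G b"
    have b: "y \<in> boundary_paths G" and m: "emb ?m \<le> pdeg y" and ya: "pmap y (0, ?m) = a"
      using y by (auto simp: cyl_iff)
    note f = boundary_functor_path[OF b]
    have "emb (?m + ?n) \<le> pdeg y \<longleftrightarrow> emb ?n \<le> pdeg (shift ?m y)"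
      using m by (simp add: emb_le_diff_iff add.commute)
    moreover have "pmap y (0, ?m + ?n) = cmp G a b \<longleftrightarrow> pmap (shift ?m y) (0, ?n) = b"
      if mn: "emb (?m + ?n) \<le> pdeg y"
    proof -
      let ?c = "pmap y (?m, ?m + ?n)"
      have le: "?m \<le> ?m + ?n" "0 \<le> ?m" "0 \<le> ?n" by (auto simp: le_fun_def)
      have "pmap (shift ?m y) (0, ?n) = ?c"
        using mn m le by (simp add: pmap_shift add.commute)
      moreover have "pmap y (0, ?m + ?n) = cmp G a ?c"
        using segment_cmp[OF f le(2,1) mn] ya by simp
      moreover have "?c \<in> paths G" "src G a = rng G ?c"
        using segment(1,2)[OF f le(1) mn] initial(3)[OF f m] ya by simp_all
      ultimately show ?thesis using cmp_left_cancel[of a ?c b] assms by auto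
    qed
    ultimately show ?thesis
      using b m boundary_shift[OF b m] assms by (auto simp: cyl_iff deg_cmp)
  qed
  then show ?thesis using sub by blast
qed

text \<open>The initial segment of \<open>z\<close> at the join of the degrees extends both paths.
  Thus the intersection of two cylinders is covered by those of their minimal common extensions,
  which are finitely many under finite alignment.\<close>

lemma cyl_Int:
  assumes "z \<in> cyl G a" "z \<in> cyl G b"
  obtains p t where "(p, t) \<in> min_ext G a b" "z \<in> cyl G (cmp G a p)"
proof -
  let ?n = "sup (deg G a) (deg G b)"
  have n: "emb ?n \<le> pdeg z" and z: "z \<in> boundary_paths G" using assms by (auto simp: cyl_iff emb_sup_le_iff)
  note f = boundary_functor_path[OF z]
  let ?c = "pmap z (0, ?n)"
  have c: "z \<in> cyl G ?c" "deg G ?c = ?n" using in_cyl_initial[OF z n] initial(4)[OF f n] by auto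
  then have "prefix a ?c" "prefix b ?c" using assms cyl_comparable by simp_all
  then obtain p t where "(p, t) \<in> min_ext G a b" "prefix (cmp G a p) ?c"
    by (rule min_ext_of_common_extension)
  then show ?thesis using that c(1) cyl_antimono by blast
qed

text \<open>Uniqueness of the path obtained by prepending \<open>a\<close>: membership in the
  cylinder of any extension of \<open>a\<close> depends only on the shift.\<close>

lemma cyl_prepend_inject:
  assumes "u \<in> cyl G a" "v \<in> cyl G a" "shift (deg G a) u = shift (deg G a) v"
  shows "u = v"
proof -
  let ?d = "deg G a"
  have u: "u \<in> boundary_paths G" "emb ?d \<le> pdeg u" and v: "v \<in> boundary_paths G" "emb ?d \<le> pdeg v"
    using assms by (auto simp: cyl_iff)
  have same: "u \<in> cyl G b \<longleftrightarrow> v \<in> cyl G b" if b: "prefix a b" for b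
    using b assms cyl_cmp_iff unfolding prefix_def by metis
  have deg: "pdeg u - emb ?d = pdeg v - emb ?d" using assms(3) by (metis pdeg_shift)
  \<comment> \<open>The truncated subtraction can be undone because both degrees dominate
    \<open>?d\<close>.\<close>
  have eq: "pdeg u = pdeg v"
  proof
    fix i
    have "pdeg u i - enat (?d i) = pdeg v i - enat (?d i)" "enat (?d i) \<le> pdeg u i" "enat (?d i) \<le> pdeg v i"
      using fun_cong[OF deg, of i] u v by (auto simp: emb_def le_fun_def)
    then show "pdeg u i = pdeg v i" by (cases "pdeg u i"; cases "pdeg v i") auto
  qed
  have "pmap u (0, n) = pmap v (0, n)" if n: "emb n \<le> pdeg u" for n
  proof -
    \<comment> \<open>A degree \<open>n\<close> need not be comparable with \<open>?d\<close>. At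
      the join, \<open>a\<close> is a prefix and \<open>same\<close> applies; the initial segment of
      degree \<open>n\<close> is then recovered as a prefix.\<close>
    let ?N = "sup n ?d"
    have N: "emb ?N \<le> pdeg u" "emb ?N \<le> pdeg v" using n u v eq by (auto simp: emb_sup_le_iff)
    have "prefix a (pmap u (0, ?N))"
      using cyl_comparable[OF assms(1) in_cyl_initial[OF u(1) N(1)]]
        initial(4)[OF boundary_functor_path[OF u(1)] N(1)] by simp
    then have "v \<in> cyl G (pmap u (0, ?N))" using same in_cyl_initial[OF u(1) N(1)] by blast
    then have "v \<in> cyl G (pmap u (0, n))"
      using cyl_antimono prefix_initial[OF boundary_functor_path[OF u(1)] _ N(1), of n] by auto
    then show ?thesis using initial(4)[OF boundary_functor_path[OF u(1)] n] by (simp add: cyl_iff)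
  qed
  with eq show ?thesis using functor_path_eqI boundary_functor_path u v by blast
qed

end

section \<open>Prepending boundary paths under finite alignment\<close>

locale finitely_aligned_graph = higher_rank_graph G
  for G :: "('a, 'k::finite) hrgraph" +
  assumes finitely_aligned: "finitely_aligned G"
begin

text \<open>A finite exhaustive set \<open>E\<close> at \<open>n\<close> is carried along
  \<open>x\<close> to the join of \<open>n\<close> and \<open>d\<close> by \<open>ext\<close>: the
  result is finite by finite alignment and exhaustive by \<open>exhaustive_ext\<close>. There the
  boundary condition of the shift applies, and the member of \<open>ext\<close> that
  \<open>x\<close> follows completes a member of \<open>E\<close>.\<close>

lemma boundary_of_shift:
  assumes f: "functor_path x" and d: "emb d \<le> pdeg x" and s: "shift d x \<in> boundary_paths G"
  shows "x \<in> boundary_paths G"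
  unfolding boundary_paths_iff
proof (intro conjI allI impI f)
  fix n E assume n: "emb n \<le> pdeg x" and E: "finite E" "exhaustive G (pmap x (n, n)) E"
  let ?N = "sup n d"
  let ?b = "pmap x (n, ?N)"
  have N: "emb ?N \<le> pdeg x" "n \<le> ?N" "d \<le> ?N" using n d by (auto simp: emb_sup_le_iff)
  have Nd: "?N - d + d = ?N" using tuple_le_add_diff[OF N(3)] by (simp add: add.commute)
  have b: "?b \<in> paths G" "rng G ?b = pmap x (n, n)" "src G ?b = pmap x (?N, ?N)" "deg G ?b = ?N - n"
    using segment[OF f N(2,1)] by auto
  have Ep: "E \<subseteq> paths G" using E by (auto simp: exhaustive_def vpaths_def)
  have "finite (ext ?b E)" using finite_ext finitely_aligned b Ep E by blast
  moreover have "exhaustive G (pmap (shift d x) (?N - d, ?N - d)) (ext ?b E)"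
    using exhaustive_ext[of ?b E] b E d N by (simp add: pmap_shift Nd)
  moreover have "emb (?N - d) \<le> pdeg (shift d x)" using d N by (simp add: emb_le_diff_iff Nd)
  ultimately obtain p where p: "p \<in> ext ?b E" "emb (?N - d + deg G p) \<le> pdeg (shift d x)"
    "pmap (shift d x) (?N - d, ?N - d + deg G p) = p"
    using s unfolding boundary_paths_iff by blast
  let ?M = "?N + deg G p"
  have M: "?N - d + deg G p + d = ?M" using Nd by (metis add.assoc add.commute)
  have Mle: "emb ?M \<le> pdeg x" using p(2) d by (simp add: emb_le_diff_iff M)
  have NM: "?N \<le> ?M" "?N - d \<le> ?N - d + deg G p" by (auto simp: le_fun_def)
  have xp: "pmap x (?N, ?M) = p"
    using p(3) pmap_shift[OF d NM(2)] Mle by (simp add: M Nd)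
  obtain e t where e: "e \<in> E" and "(p, t) \<in> min_ext G ?b e" using p(1) by (auto simp: ext_def)
  note pt = min_extD[OF this(2)]
  have eG: "e \<in> paths G" using e Ep by blast
  have xM: "pmap x (n, ?M) = cmp G e t"
    using segment_cmp[OF f N(2) NM(1) Mle] xp pt by simp
  then have "?M - n = deg G e + deg G t"
    using segment(4)[OF f order_trans[OF N(2) NM(1)] Mle] deg_cmp pt eG by simp
  then have "?M = n + deg G e + deg G t"
    using tuple_le_add_diff[OF order_trans[OF N(2) NM(1)]] by (simp add: add.assoc)
  then have le: "n + deg G e \<le> ?M" "n \<le> n + deg G e" by (auto simp: le_fun_def)
  then have ne: "emb (n + deg G e) \<le> pdeg x" using Mle emb_mono by blast
  let ?e = "pmap x (n, n + deg G e)"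
  \<comment> \<open>Both sides factor the same segment of \<open>x\<close> with first factors of
    degree \<open>deg G e\<close>, so \<open>?e\<close> must be \<open>e\<close>.\<close>
  have "cmp G ?e (pmap x (n + deg G e, ?M)) = cmp G e t"
    using segment_cmp[OF f le(2,1) Mle] xM by simp
  moreover have "deg G ?e = deg G e" using segment(4)[OF f le(2) ne] by simp
  ultimately have "?e = e"
    using cmp_eq_cmpD(1)[of ?e "pmap x (n + deg G e, ?M)" e t] segment[OF f le(2) ne] segment[OF f le(1) Mle]
      pt eG by simp
  then show "\<exists>a\<in>E. emb (n + deg G a) \<le> pdeg x \<and> pmap x (n, n + deg G a) = a"
    using e ne by blast
qed

lemma ex_prepend:
  assumes a: "a \<in> paths G" and z: "z \<in> boundary_paths G" and az: "prange z = src G a"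
  obtains y where "y \<in> cyl G a" "shift (deg G a) y = z"
proof -
  let ?d = "deg G a"
  define m where "m = emb ?d + pdeg z"
  have dm: "emb ?d \<le> m" by (simp add: m_def le_fun_def)
  have md: "m - emb ?d = pdeg z" by (simp add: m_def emb_add_diff)
  note fz = boundary_functor_path[OF z]
  have Nd: "sup n ?d - ?d + ?d = sup n ?d" for n
    using tuple_le_add_diff[of ?d "sup n ?d"] by (simp add: add.commute)
  \<comment> \<open>Only degrees above \<open>?d\<close> can be read off as \<open>a\<close>
    followed by a segment of \<open>z\<close>. For other \<open>n\<close> one goes up to the join
    with \<open>?d\<close>; the initial segment \<open>f n\<close> is then cut out of
    \<open>g n\<close>.\<close>
  define g where "g n = cmp G a (pmap z (0, sup n ?d - ?d))" for n
  have le: "emb (sup n ?d - ?d) \<le> pdeg z" if "emb n \<le> m" for n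
    using that dm md emb_le_diff_iff[OF dm, of "sup n ?d - ?d"] by (simp add: Nd emb_sup_le_iff)
  have z0: "pmap z (0, n) \<in> paths G" "src G a = rng G (pmap z (0, n))" "deg G (pmap z (0, n)) = n"
    if "emb n \<le> pdeg z" for n
    using initial[OF fz that] az by auto
  have g: "g n \<in> paths G" "deg G (g n) = sup n ?d" if "emb n \<le> m" for n
  proof -
    show "g n \<in> paths G" unfolding g_def using z0[OF le[OF that]] a by (simp add: cmp_in)
    show "deg G (g n) = sup n ?d"
      unfolding g_def using z0[OF le[OF that]] a Nd[of n] by (simp add: deg_cmp add.commute)
  qed
  have gmono: "prefix (g n) (g n')" if "n \<le> n'" "emb n' \<le> m" for n n'
  proof -
    have "emb n \<le> m" using that emb_mono by blast
    moreover have "sup n ?d - ?d \<le> sup n' ?d - ?d"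
      using that(1) by (auto simp: le_fun_def sup_max intro!: diff_le_mono max.mono)
    ultimately show ?thesis
      unfolding g_def using a z0 le that(2) prefix_initial[OF fz _ le[OF that(2)]]
      by (intro prefix_cmp_cmp_iff[THEN iffD2]) auto
  qed
  define f where "f n = (SOME c. prefix c (g n) \<and> deg G c = n)" for n
  have f: "prefix (f n) (g n)" "deg G (f n) = n" if n: "emb n \<le> m" for n
  proof -
    have "n \<le> deg G (g n)" using g[OF n] by simp
    then have "\<exists>c. prefix c (g n) \<and> deg G c = n"
      using factorE[OF g(1)[OF n]] prefixI by metis
    then show "prefix (f n) (g n)" "deg G (f n) = n" unfolding f_def by (metis (mono_tags, lifting) someI_ex)+
  qed
  have fmono: "prefix (f n) (f n')" if "n \<le> n'" "emb n' \<le> m" for n n'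
    using prefix_of_prefixes[of "f n" "g n'" "f n'"] prefix_trans[OF f(1)[OF emb_mono[OF that]] gmono[OF that]]
      f[OF that(2)] f(2)[OF emb_mono[OF that]] that(1) by simp
  obtain x where x: "functor_path x" "pdeg x = m" "\<And>n. emb n \<le> m \<Longrightarrow> pmap x (0, n) = f n"
  proof (rule functor_path_of_initials[of m f])
    show "f n \<in> paths G \<and> deg G (f n) = n" if "emb n \<le> m" for n
      using f[OF that] prefix_in by blast
  qed (use fmono in auto)
  have fd: "f (n + ?d) = cmp G a (pmap z (0, n))" if n: "emb n \<le> pdeg z" for n
  proof -
    have nd: "emb (n + ?d) \<le> m" using n emb_le_diff_iff[OF dm] md by simp
    have "sup (n + ?d) ?d = n + ?d" by (auto simp: fun_eq_iff sup_max)
    then have gd: "g (n + ?d) = cmp G a (pmap z (0, n))" "deg G (g (n + ?d)) = n + ?d"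
      using g[OF nd] by (auto simp: g_def)
    have "prefix (g (n + ?d)) (g (n + ?d))" using gmono nd by blast
    then have "f (n + ?d) = g (n + ?d)" by (rule prefix_same_deg[OF f(1)[OF nd]]) (simp only: f(2)[OF nd] gd(2))
    then show ?thesis using gd by simp
  qed
  have "prefix a (f ?d)"
    using fd[of 0] prefixI[of a "pmap z (0, 0)"] z0[of 0] a by simp
  moreover have "f ?d \<in> paths G" using f(1)[OF dm] prefix_in by blast
  ultimately have fa: "f ?d = a"
    using prefix_same_deg[of "f ?d" "f ?d" a] fmono[OF order_refl dm] f(2)[OF dm] by simp
  have "shift ?d x = z"
  proof (rule functor_path_eqI)
    show "functor_path (shift ?d x)" using functor_path_shift x dm by simp
    show "functor_path z" by (rule fz)
    show "pdeg (shift ?d x) = pdeg z" using x md by simp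
    fix n assume "emb n \<le> pdeg (shift ?d x)"
    then have n: "emb n \<le> pdeg z" "emb (n + ?d) \<le> m" using x(2) md emb_le_diff_iff[OF dm] by auto
    have dn: "?d \<le> n + ?d" "0 \<le> ?d" "0 \<le> n" by (auto simp: le_fun_def)
    let ?s = "pmap x (?d, n + ?d)"
    have "cmp G a ?s = cmp G a (pmap z (0, n))"
      using segment_cmp[OF x(1) dn(2,1)] x n dm fa fd by simp
    moreover have "?s \<in> paths G" "src G a = rng G ?s"
      using segment(1,2)[OF x(1) dn(1)] initial(3)[OF x(1), of ?d] x(2,3) n dm fa by auto
    ultimately have "?s = pmap z (0, n)" using cmp_left_cancel a z0[OF n(1)] by blast
    then show "pmap (shift ?d x) (0, n) = pmap z (0, n)"
      using pmap_shift[of ?d x 0 n] x(2) dm n dn by simp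
  qed
  moreover from this have "x \<in> boundary_paths G" using boundary_of_shift x(1,2) dm z by metis
  ultimately show ?thesis using that[of x] x dm fa by (simp add: cyl_iff)
qed

section \<open>Limits and the topology of the boundary path space\<close>

text \<open>
  The paths \<open>b\<close> whose cylinder contains some \<open>A j\<close> pairwise have a common extension;
  by finite alignment each two of them have a minimal common extension among them, so they are
  exactly the initial segments of one path \<open>w\<close>. That \<open>w\<close> is a boundary path is inherited from
  the members of the \<open>A j\<close>.
\<close>

lemma boundary_limit:
  fixes A :: "nat \<Rightarrow> ('a, 'k) gpath set"
  assumes dec: "decseq A" and ne: "\<And>j. A j \<noteq> {}" and bd: "\<And>j. A j \<subseteq> boundary_paths G"
    and v: "A 0 \<subseteq> cyl G v"
    and decide: "\<And>b. b \<in> paths G \<Longrightarrow> \<exists>j. A j \<subseteq> cyl G b \<or> A j \<inter> cyl G b = {}"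
  obtains w where "w \<in> boundary_paths G" "\<And>b. w \<in> cyl G b \<longleftrightarrow> (\<exists>j. A j \<subseteq> cyl G b)"
proof -
  define S where "S = {b. \<exists>j. A j \<subseteq> cyl G b}"
  have A_mono: "A j \<subseteq> A i" if "i \<le> j" for i j using dec that by (auto simp: decseq_def)
  have S_paths: "b \<in> paths G" if "b \<in> S" for b
    using that ne cyl_in_paths unfolding S_def by blast
  have S_prefix: "a \<in> S" if "prefix a b" "b \<in> S" for a b
    using that cyl_antimono unfolding S_def by blast
  have S_Int: "\<exists>j. A j \<subseteq> cyl G a \<inter> cyl G b" if ab: "a \<in> S" "b \<in> S" for a b
  proof -
    obtain i j where "A i \<subseteq> cyl G a" "A j \<subseteq> cyl G b" using ab by (auto simp: S_def)
    then have "A (max i j) \<subseteq> cyl G a \<inter> cyl G b"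
      using A_mono[of i "max i j"] A_mono[of j "max i j"] by auto
    then show ?thesis by blast
  qed
  have avoid: "\<exists>j. \<forall>b\<in>B. A j \<inter> cyl G b = {}" if "finite B" "B \<subseteq> paths G" "B \<inter> S = {}" for B
    using that
  proof (induction B rule: finite_induct)
    case (insert b B)
    then obtain i where i: "\<forall>b\<in>B. A i \<inter> cyl G b = {}" by auto
    obtain j where j: "A j \<inter> cyl G b = {}"
      using decide[of b] insert.prems by (auto simp: S_def)
    show ?case
      using i j A_mono[of i "max i j"] A_mono[of j "max i j"]
      by (intro exI[of _ "max i j"]) fastforce
  qed simp
  \<comment> \<open>The substitute for compactness: if finitely many cylinders cover some
    \<open>A j\<close>, one of their paths lies in \<open>S\<close>, since otherwise a later,
    nonempty set of the sequence would miss them all.\<close>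
  have meets: "\<exists>b\<in>B. b \<in> S" if B: "finite B" "B \<subseteq> paths G" "A j \<subseteq> (\<Union>b\<in>B. cyl G b)" for B j
  proof (rule ccontr)
    assume "\<not> ?thesis"
    then obtain i where i: "\<forall>b\<in>B. A i \<inter> cyl G b = {}" using avoid[OF B(1,2)] by blast
    obtain y where "y \<in> A (max i j)" using ne by blast
    then show False using i B(3) A_mono[of i "max i j"] A_mono[of j "max i j"] by fastforce
  qed
  \<comment> \<open>By finite alignment the minimal common extensions give a finite cover of some
    \<open>A j\<close>, so \<open>meets\<close> selects one of them.\<close>
  have S_join: "\<exists>c\<in>S. deg G c = sup (deg G a) (deg G b)" if ab: "a \<in> S" "b \<in> S" for a b
  proof -
    let ?B = "(\<lambda>(p, t). cmp G a p) ` min_ext G a b"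
    obtain j where j: "A j \<subseteq> cyl G a \<inter> cyl G b" using S_Int ab by blast
    have "finite ?B" using finitely_aligned S_paths ab by (auto simp: finitely_aligned_def)
    moreover have "cmp G a p \<in> paths G" if "(p, t) \<in> min_ext G a b" for p t
      using min_extD(1,3)[OF that] S_paths[OF ab(1)] cmp_in by blast
    then have "?B \<subseteq> paths G" by auto
    moreover have "A j \<subseteq> (\<Union>c\<in>?B. cyl G c)"
    proof
      fix y assume "y \<in> A j"
      then obtain p t where "(p, t) \<in> min_ext G a b" "y \<in> cyl G (cmp G a p)"
        using j cyl_Int by blast
      then show "y \<in> (\<Union>c\<in>?B. cyl G c)" by force
    qed
    ultimately obtain c where "c \<in> ?B" "c \<in> S" using meets by metis
    then show ?thesis by (auto dest: min_extD(6))
  qed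
  have vS: "v \<in> S" using v by (auto simp: S_def)
  have S_comparable: "prefix a b" if ab: "a \<in> S" "b \<in> S" "deg G a \<le> deg G b" for a b
  proof -
    obtain y where "y \<in> cyl G a" "y \<in> cyl G b" using S_Int[OF ab(1,2)] ne by blast
    then show ?thesis using cyl_comparable ab(3) by blast
  qed
  \<comment> \<open>The degree of the limit: infinite in exactly those coordinates where the degrees
    of paths in \<open>S\<close> are unbounded.\<close>
  define m where "m i = (SUP b\<in>S. enat (deg G b i))" for i
  have degm: "emb (deg G b) \<le> m" if "b \<in> S" for b
    using that by (auto simp: emb_def le_fun_def m_def intro: SUP_upper)
  have S_deg: "\<exists>b\<in>S. deg G b = n" if n: "emb n \<le> m" for n
  proof -
    have one: "\<exists>b\<in>S. n i \<le> deg G b i" for i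
    proof (cases "n i")
      case (Suc t)
      then have "enat t < enat (n i)" by simp
      also have "\<dots> \<le> m i" using n by (auto simp: emb_def le_fun_def)
      finally obtain b where "b \<in> S" "t < deg G b i" by (auto simp: m_def less_SUP_iff)
      then show ?thesis using Suc by (intro bexI[of _ b]) simp_all
    qed (use vS in auto)
    \<comment> \<open>Joins inside \<open>S\<close> handle the finitely many coordinates one after
      another; a prefix of the resulting path then has degree exactly \<open>n\<close>.\<close>
    have "\<exists>b\<in>S. \<forall>i\<in>I. n i \<le> deg G b i" if "finite I" for I
      using that
    proof (induction I rule: finite_induct)
      case (insert i I)
      then obtain b where b: "b \<in> S" "\<forall>i\<in>I. n i \<le> deg G b i" by blast
      obtain c where c: "c \<in> S" "n i \<le> deg G c i" using one[of i] by blast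
      obtain d where "d \<in> S" "deg G d = sup (deg G b) (deg G c)" using S_join[OF b(1) c(1)] by blast
      moreover have "\<forall>j\<in>insert i I. n j \<le> sup (deg G b j) (deg G c j)"
        using b(2) c(2) by (auto simp: sup_max le_max_iff_disj)
      ultimately show ?case by (intro bexI[of _ d]) simp_all
    qed (use vS in auto)
    from this[of UNIV] obtain b where b: "b \<in> S" "n \<le> deg G b" by (auto simp: le_fun_def)
    then obtain a where "prefix a b" "deg G a = n" 
      using factorE[OF S_paths[OF b(1)] b(2)] prefixI by metis
    then show ?thesis using S_prefix b(1) by blast
  qed
  define f where "f n = (SOME b. b \<in> S \<and> deg G b = n)" for n
  have f: "f n \<in> S" "deg G (f n) = n" if "emb n \<le> m" for n
    unfolding f_def using someI_ex[of "\<lambda>b. b \<in> S \<and> deg G b = n"] S_deg[OF that] by auto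
  have fS: "f (deg G b) = b" if "b \<in> S" for b
    using prefix_same_deg[of "f (deg G b)" b b] S_comparable f[OF degm[OF that]] that by simp
  obtain w where w: "functor_path w" "pdeg w = m" "\<And>n. emb n \<le> m \<Longrightarrow> pmap w (0, n) = f n"
  proof (rule functor_path_of_initials[of m f])
    show "f n \<in> paths G \<and> deg G (f n) = n" if "emb n \<le> m" for n
      using f[OF that] S_paths by blast
    show "prefix (f n) (f n')" if "n \<le> n'" "emb n' \<le> m" for n n'
      using S_comparable f[OF that(2)] f[OF emb_mono[OF that]] that(1) by simp
  qed auto
  have "w \<in> boundary_paths G"
    unfolding boundary_paths_iff
  proof (intro conjI allI impI w(1))
    fix n E assume "emb n \<le> pdeg w" and E: "finite E" "exhaustive G (pmap w (n, n)) E"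
    then have n: "emb n \<le> m" using w by simp
    note fn = f[OF n]
    have fnG: "f n \<in> paths G" "src G (f n) = pmap w (n, n)"
      using S_paths[OF fn(1)] initial(3)[OF w(1), of n] w(2,3) n by auto
    have EG: "e \<in> paths G \<and> rng G e = src G (f n)" if "e \<in> E" for e
      using that E fnG by (auto simp: exhaustive_def vpaths_def)
    obtain j where j: "A j \<subseteq> cyl G (f n)" using fn by (auto simp: S_def)
    \<comment> \<open>Every member of \<open>A j\<close> is a boundary path through
      \<open>f n\<close>, so it follows some element of \<open>E\<close>. This finite cover lets
      \<open>meets\<close> choose one element for the limit.\<close>
    have "A j \<subseteq> (\<Union>e\<in>E. cyl G (cmp G (f n) e))"
    proof
      fix y assume "y \<in> A j"
      then have y: "y \<in> cyl G (f n)" "y \<in> boundary_paths G" using j bd by auto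
      then have yn: "emb n \<le> pdeg y" "pmap y (0, n) = f n" using fn by (auto simp: cyl_iff)
      then have "exhaustive G (pmap y (n, n)) E"
        using initial(3)[OF boundary_functor_path[OF y(2)] yn(1)] fnG E by simp
      then obtain e where e: "e \<in> E" "emb (n + deg G e) \<le> pdeg y" "pmap y (n, n + deg G e) = e"
        using y(2) yn(1) E(1) unfolding boundary_paths_iff by blast
      have "0 \<le> deg G e" by (simp add: le_fun_def)
      then have "pmap (shift n y) (0, deg G e) = e" "emb (deg G e) \<le> pdeg (shift n y)"
        using e yn pmap_shift[of n y 0 "deg G e"] by (simp_all add: emb_le_diff_iff add.commute)
      then have "shift n y \<in> cyl G e" using boundary_shift y(2) yn(1) by (simp add: cyl_iff)
      then have "y \<in> cyl G (cmp G (f n) e)" using cyl_cmp_iff fnG EG[OF e(1)] y(1) fn by simp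
      then show "y \<in> (\<Union>e\<in>E. cyl G (cmp G (f n) e))" using e(1) by blast
    qed
    then have "\<exists>b\<in>cmp G (f n) ` E. b \<in> S"
      using E(1) EG fnG by (intro meets[of _ j]) (auto simp: cmp_in)
    then obtain e where e: "e \<in> E" "cmp G (f n) e \<in> S" by blast
    have d: "deg G (cmp G (f n) e) = n + deg G e" using deg_cmp EG[OF e(1)] fnG fn by simp
    then have ne: "emb (n + deg G e) \<le> m" using degm[OF e(2)] by simp
    have le: "0 \<le> n" "n \<le> n + deg G e" by (auto simp: le_fun_def)
    let ?e = "pmap w (n, n + deg G e)"
    have "cmp G (f n) ?e = cmp G (f n) e"
      using segment_cmp[OF w(1) le] w(2,3) n ne fS[OF e(2)] d by simp
    moreover have "?e \<in> paths G" "rng G ?e = src G (f n)"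
      using segment[OF w(1) le(2)] w(2) ne fnG by simp_all
    ultimately have "?e = e" using cmp_left_cancel[of "f n" ?e e] fnG EG[OF e(1)] by simp
    then show "\<exists>a\<in>E. emb (n + deg G a) \<le> pdeg w \<and> pmap w (n, n + deg G a) = a"
      using e(1) ne w(2) by blast
  qed
  moreover have "w \<in> cyl G b \<longleftrightarrow> b \<in> S" for b
    using \<open>w \<in> boundary_paths G\<close> w(2,3) f fS degm by (auto simp: cyl_iff) metis
  ultimately show ?thesis using that by (simp add: S_def)
qed

text \<open>Basic neighbourhoods of \<open>y\<close> can be based at any longer initial segment.
  Writing it as \<open>cmp G a c\<close>, the excluded set becomes \<open>ext c F\<close>: inside
  the smaller cylinder, lying in some \<open>cyl G (cmp G a e)\<close> with \<open>e\<close> in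
  \<open>F\<close> amounts to lying in the cylinder of an extension by a member of
  \<open>ext c F\<close>.\<close>

lemma cyl_diff_refine:
  assumes y: "y \<in> cyl_diff G a F" and F: "finite F" "F \<subseteq> vpaths G (src G a)"
    and q: "emb q \<le> pdeg y" "deg G a \<le> q"
  obtains K where "finite K" "K \<subseteq> vpaths G (src G (pmap y (0, q)))"
    "y \<in> cyl_diff G (pmap y (0, q)) K" "cyl_diff G (pmap y (0, q)) K \<subseteq> cyl_diff G a F"
proof -
  let ?b = "pmap y (0, q)"
  have ya: "y \<in> cyl G a" and yF: "\<And>e. e \<in> F \<Longrightarrow> y \<notin> cyl G (cmp G a e)"
    using y by (auto simp: cyl_diff_def)
  have yb: "y \<in> boundary_paths G" using ya by (auto simp: cyl_iff)
  have aG: "a \<in> paths G" using ya by (rule cyl_in_paths)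
  have "deg G ?b = q" using initial(4) boundary_functor_path yb q(1) by blast
  then have "prefix a ?b" using cyl_comparable[OF ya in_cyl_initial[OF yb q(1)]] q(2) by simp
  then obtain c where c: "c \<in> paths G" "src G a = rng G c" "?b = cmp G a c" by (auto simp: prefix_def)
  have FG: "e \<in> paths G \<and> src G a = rng G e" if "e \<in> F" for e using F that by (auto simp: vpaths_def)
  let ?K = "ext c F"
  have "finite ?K" using finite_ext[OF finitely_aligned c(1) _ F(1)] FG by blast
  moreover have "?K \<subseteq> vpaths G (src G ?b)" using ext_subset[of c F] c aG by (simp add: src_cmp)
  moreover have "y \<notin> cyl G (cmp G ?b p)" if "p \<in> ?K" for p
  proof -
    obtain e t where e: "e \<in> F" and "(p, t) \<in> min_ext G c e" using \<open>p \<in> ?K\<close> by (auto simp: ext_def)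
    note pt = min_extD[OF this(2)]
    have "cmp G ?b p = cmp G (cmp G a e) t"
      using c pt aG FG[OF e] by (simp add: cmp_assoc)
    moreover have "cyl G (cmp G (cmp G a e) t) \<subseteq> cyl G (cmp G a e)"
      using pt aG FG[OF e] by (intro cyl_antimono prefixI) (auto simp: cmp_in src_cmp)
    ultimately show ?thesis using yF[OF e] by auto
  qed
  then have "y \<in> cyl_diff G ?b ?K" using in_cyl_initial[OF yb q(1)] by (auto simp: cyl_diff_def)
  moreover have "cyl_diff G ?b ?K \<subseteq> cyl_diff G a F"
  proof
    fix u assume "u \<in> cyl_diff G ?b ?K"
    then have u: "u \<in> cyl G ?b" "\<And>p. p \<in> ?K \<Longrightarrow> u \<notin> cyl G (cmp G ?b p)" by (auto simp: cyl_diff_def)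
    have "u \<notin> cyl G (cmp G a e)" if e: "e \<in> F" for e
    proof
      assume "u \<in> cyl G (cmp G a e)"
      then have "shift (deg G a) u \<in> cyl G e" using cyl_cmp_iff aG FG[OF e] by blast
      moreover have u2: "u \<in> cyl G a" "shift (deg G a) u \<in> cyl G c"
        using u(1) unfolding c(3) cyl_cmp_iff[OF aG c(1,2)] by blast+
      ultimately obtain p t where pt: "(p, t) \<in> min_ext G c e" "shift (deg G a) u \<in> cyl G (cmp G c p)"
        using cyl_Int by blast
      note pt' = min_extD[OF pt(1)]
      have "u \<in> cyl G (cmp G a (cmp G c p))"
        using cyl_cmp_iff[of a "cmp G c p" u] pt(2) pt'(1,3) c(1,2) aG u2(1) by (simp add: cmp_in rng_cmp)
      then have "u \<in> cyl G (cmp G ?b p)" using c pt' aG by (simp add: cmp_assoc)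
      moreover have "p \<in> ?K" using pt(1) e by (force simp: ext_def)
      ultimately show False using u(2) by blast
    qed
    moreover have "u \<in> cyl G a" using u(1) unfolding c(3) cyl_cmp_iff[OF aG c(1,2)] by blast
    ultimately show "u \<in> cyl_diff G a F" by (auto simp: cyl_diff_def)
  qed
  ultimately show ?thesis using that by blast
qed

section \<open>Basic neighbourhoods and separation of points\<close>

definition contains_nbhd :: "('a, 'k) gpath set \<Rightarrow> ('a, 'k) gpath \<Rightarrow> bool" where
  "contains_nbhd U y \<longleftrightarrow> (\<exists>a F. a \<in> paths G \<and> finite F \<and> F \<subseteq> vpaths G (src G a)
     \<and> y \<in> cyl_diff G a F \<and> cyl_diff G a F \<subseteq> U)"

lemma cyl_diff_subset: "cyl_diff G a F \<subseteq> cyl G a"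
  by (auto simp: cyl_diff_def)

lemma contains_nbhdE:
  assumes "contains_nbhd U y" "emb n \<le> pdeg y"
  obtains q K where "emb q \<le> pdeg y" "n \<le> q" "finite K" "K \<subseteq> vpaths G (src G (pmap y (0, q)))"
    "y \<in> cyl_diff G (pmap y (0, q)) K" "cyl_diff G (pmap y (0, q)) K \<subseteq> U"
proof -
  obtain a F where aF: "finite F" "F \<subseteq> vpaths G (src G a)" "y \<in> cyl_diff G a F" "cyl_diff G a F \<subseteq> U"
    using assms(1) by (auto simp: contains_nbhd_def)
  let ?q = "sup n (deg G a)"
  have q: "emb ?q \<le> pdeg y" "n \<le> ?q" "deg G a \<le> ?q"
    using aF assms(2) by (auto simp: emb_sup_le_iff cyl_diff_def cyl_iff[of y a])
  obtain K where "finite K" "K \<subseteq> vpaths G (src G (pmap y (0, ?q)))"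
    "y \<in> cyl_diff G (pmap y (0, ?q)) K" "cyl_diff G (pmap y (0, ?q)) K \<subseteq> cyl_diff G a F"
    using cyl_diff_refine[OF aF(3,1,2) q(1,3)] by blast
  then show ?thesis using that[OF q(1,2)] aF(4) by blast
qed

text \<open>After refinement both neighbourhoods are based at the same initial segment of
  \<open>y\<close>; intersecting them then only unites the excluded sets.\<close>

lemma contains_nbhd_Int:
  assumes "contains_nbhd U y" "contains_nbhd V y"
  shows "contains_nbhd (U \<inter> V) y"
proof -
  obtain b H where H: "b \<in> paths G" "finite H" "H \<subseteq> vpaths G (src G b)" "y \<in> cyl_diff G b H" "cyl_diff G b H \<subseteq> V"
    using assms(2) by (auto simp: contains_nbhd_def)
  then have yb: "y \<in> boundary_paths G" "emb (deg G b) \<le> pdeg y" by (auto simp: cyl_diff_def cyl_iff[of y b])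
  from contains_nbhdE[OF assms(1) yb(2)] obtain q K where K: "emb q \<le> pdeg y" "deg G b \<le> q" "finite K"
    "K \<subseteq> vpaths G (src G (pmap y (0, q)))" "y \<in> cyl_diff G (pmap y (0, q)) K"
    "cyl_diff G (pmap y (0, q)) K \<subseteq> U" by blast
  obtain L where L: "finite L" "L \<subseteq> vpaths G (src G (pmap y (0, q)))"
    "y \<in> cyl_diff G (pmap y (0, q)) L" "cyl_diff G (pmap y (0, q)) L \<subseteq> cyl_diff G b H"
    using cyl_diff_refine[OF H(4,2,3) K(1,2)] by blast
  have "cyl_diff G a (K \<union> L) = cyl_diff G a K \<inter> cyl_diff G a L" for a
    by (auto simp: cyl_diff_def)
  moreover have "pmap y (0, q) \<in> paths G" using initial(1) boundary_functor_path yb K(1) by blast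
  ultimately show ?thesis
    unfolding contains_nbhd_def using K L H(5)
    by (intro exI[of _ "pmap y (0, q)"] exI[of _ "K \<union> L"]) auto
qed

lemma contains_nbhd_mono: "contains_nbhd U y \<Longrightarrow> U \<subseteq> V \<Longrightarrow> contains_nbhd V y"
  unfolding contains_nbhd_def by blast

lemma openin_cyl_diff:
  assumes "a \<in> paths G" "finite F" "F \<subseteq> vpaths G (src G a)"
  shows "openin (boundary_topology G) (cyl_diff G a F)"
  unfolding boundary_topology_def using assms by (intro topology_generated_by_Basis) blast

text \<open>The topology is defined by a generating family; closure under intersection in the sense
  of \<open>contains_nbhd_Int\<close> shows that this family is even a base.\<close>

lemma openin_boundary_iff:
  "openin (boundary_topology G) U \<longleftrightarrow> (\<forall>y\<in>U. contains_nbhd U y)"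
proof
  assume "openin (boundary_topology G) U"
  then have "generate_topology_on {cyl_diff G a F | a F. a \<in> paths G \<and> finite F \<and> F \<subseteq> vpaths G (src G a)} U"
    by (simp add: boundary_topology_def openin_topology_generated_by_iff)
  then show "\<forall>y\<in>U. contains_nbhd U y"
  proof (induction rule: generate_topology_on.induct)
    case (Int a b) then show ?case using contains_nbhd_Int by blast
  next
    case (UN K) then show ?case using contains_nbhd_mono by (metis Union_iff Union_upper)
  next
    case (Basis s) then show ?case unfolding contains_nbhd_def by blast
  qed simp
next
  assume "\<forall>y\<in>U. contains_nbhd U y"
  then show "openin (boundary_topology G) U"
    by (subst openin_subopen) (metis contains_nbhd_def openin_cyl_diff)
qed

lemma openin_cyl: "a \<in> paths G \<Longrightarrow> openin (boundary_topology G) (cyl G a)"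
  using openin_cyl_diff[of a "{}"] by (simp add: cyl_diff_def)

text \<open>Distinct boundary paths are told apart by some cylinder. If it contains only
  \<open>y\<close>, then \<open>x\<close> is separated from \<open>y\<close> by excluding that
  cylinder from the one at the range of \<open>x\<close>, or by the latter alone when the ranges
  differ.\<close>

lemma t1_boundary:
  assumes x: "x \<in> boundary_paths G" and y: "y \<in> boundary_paths G" and "x \<noteq> y"
  obtains V where "openin (boundary_topology G) V" "x \<in> V" "y \<notin> V"
proof -
  note fx = boundary_functor_path[OF x] and fy = boundary_functor_path[OF y]
  have "\<exists>b. x \<in> cyl G b \<longleftrightarrow> y \<notin> cyl G b"
  proof (rule ccontr)
    assume "\<not> ?thesis"
    then have same: "\<And>b. x \<in> cyl G b \<longleftrightarrow> y \<in> cyl G b" by blast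
    have agree: "emb n \<le> pdeg y' \<and> pmap x' (0, n) = pmap y' (0, n)"
      if "emb n \<le> pdeg x'" "x' \<in> boundary_paths G" "\<And>b. x' \<in> cyl G b \<longleftrightarrow> y' \<in> cyl G b" for n x' y'
    proof -
      have "y' \<in> cyl G (pmap x' (0, n))" using in_cyl_initial[OF that(2,1)] that(3) by blast
      then show ?thesis
        using initial(4)[OF boundary_functor_path[OF that(2)] that(1)] by (simp add: cyl_iff)
    qed
    have "pdeg x = pdeg y" using agree[OF _ x] agree[OF _ y] same by (intro enat_tuple_eqI) blast
    then have "x = y" by (rule functor_path_eqI[OF fx fy]) (use agree[OF _ x] same in blast)
    then show False using \<open>x \<noteq> y\<close> by simp
  qed
  then obtain b where b: "x \<in> cyl G b \<longleftrightarrow> y \<notin> cyl G b" by blast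
  have px: "x \<in> cyl G (prange x)" "prange x \<in> paths G" using in_cyl_prange[OF x] cyl_in_paths by blast+
  show ?thesis
  proof (cases "x \<in> cyl G b")
    case True
    then show ?thesis using that openin_cyl b cyl_in_paths by blast
  next
    case nx: False
    then have yb: "y \<in> cyl G b" using b by blast
    then have bG: "b \<in> paths G" "rng G b = prange y" using cyl_in_paths cyl_rng by blast+
    show ?thesis
    proof (cases "prange x = prange y")
      case True
      have "src G (prange x) = prange x" using bG src_rng True by metis
      then have "cmp G (prange x) b = b" "{b} \<subseteq> vpaths G (src G (prange x))"
        using True bG cmp_rng_left by (metis, simp add: vpaths_def)
      then have "openin (boundary_topology G) (cyl_diff G (prange x) {b})"
        "x \<in> cyl_diff G (prange x) {b}" "y \<notin> cyl_diff G (prange x) {b}"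
        using openin_cyl_diff[of "prange x" "{b}"] px nx yb by (simp_all add: cyl_diff_def)
      then show ?thesis using that by blast
    next
      case False
      have "rng G (prange x) = prange x" using cyl_rng px(1) by blast
      then have "y \<notin> cyl G (prange x)" using False cyl_rng by metis
      then show ?thesis using that openin_cyl px by blast
    qed
  qed
qed

lemma openin_remove_point:
  "openin (boundary_topology G) (boundary_paths G - {y})"
proof (cases "y \<in> boundary_paths G")
  case True
  show ?thesis
  proof (subst openin_subopen, intro ballI)
    fix x assume "x \<in> boundary_paths G - {y}"
    then obtain V where "openin (boundary_topology G) V" "x \<in> V" "y \<notin> V" using t1_boundary True by blast
    then show "\<exists>T. openin (boundary_topology G) T \<and> x \<in> T \<and> T \<subseteq> boundary_paths G - {y}"
      using openin_subset topspace_boundary_topology by blast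
  qed
next
  case False
  then show ?thesis using openin_topspace[of "boundary_topology G"] by (simp add: topspace_boundary_topology)
qed

text \<open>A Baire category theorem for the closure of \<open>D\<close>, to which \<open>w\<close>
  belongs without having to lie in \<open>D\<close>. Basic sets meeting \<open>D\<close> are chosen
  successively inside the given open sets, each deciding the cylinder of one more path;
  \<open>boundary_limit\<close>, applied to their traces on \<open>D\<close>, yields
  \<open>w\<close>.\<close>

lemma closure_meets_dense_opens:
  assumes count: "countable (paths G)" and D: "D \<subseteq> boundary_paths G" "D \<noteq> {}"
    and \<U>: "countable \<U>" "\<And>U. U \<in> \<U> \<Longrightarrow> openin (boundary_topology G) U"
    and dense: "\<And>U V. U \<in> \<U> \<Longrightarrow> openin (boundary_topology G) V \<Longrightarrow> V \<inter> D \<noteq> {} \<Longrightarrow> V \<inter> U \<inter> D \<noteq> {}"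
  obtains w where "w \<in> boundary_paths G" "w \<in> \<Inter>\<U>"
    "\<And>V. openin (boundary_topology G) V \<Longrightarrow> w \<in> V \<Longrightarrow> V \<inter> D \<noteq> {}"
proof -
  let ?T = "boundary_topology G"
  define basic where "basic V \<longleftrightarrow> (\<exists>a F. a \<in> paths G \<and> finite F \<and> F \<subseteq> vpaths G (src G a)
     \<and> V = cyl_diff G a F)" for V
  have basic_open: "openin ?T V" if "basic V" for V using that openin_cyl_diff by (auto simp: basic_def)
  have shrink: "\<exists>V'. basic V' \<and> V' \<inter> D \<noteq> {} \<and> V' \<subseteq> V" if V: "openin ?T V" "V \<inter> D \<noteq> {}" for V
  proof -
    obtain y where "y \<in> V" "y \<in> D" using V by blast
    moreover from this have "contains_nbhd V y" using V openin_boundary_iff by blast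
    ultimately show ?thesis unfolding contains_nbhd_def basic_def by blast
  qed
  obtain x where x: "x \<in> D" using D by blast
  \<comment> \<open>Adding the whole space makes the family nonempty, so that a sequence can
    enumerate it.\<close>
  define \<U>' where "\<U>' = insert (boundary_paths G) \<U>"
  define e where "e = from_nat_into (paths G)"
  define U where "U = from_nat_into \<U>'"
  have "paths G \<noteq> {}" using x D in_cyl_prange cyl_in_paths by blast
  then have e: "range e = paths G" unfolding e_def using count by (simp add: range_from_nat_into)
  have U: "range U = \<U>'" unfolding U_def \<U>'_def using \<U>(1) by (intro range_from_nat_into) auto
  have U_cases: "U n = boundary_paths G \<or> U n \<in> \<U>" for n
    using U rangeI[of U n] by (simp add: \<U>'_def)
  have U_open: "openin ?T (U n)" for n
    using U_cases[of n] \<U>(2) openin_topspace[of ?T] by (auto simp: topspace_boundary_topology)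
  have U_dense: "V \<inter> U n \<inter> D \<noteq> {}" if V: "openin ?T V" "V \<inter> D \<noteq> {}" for V n
    using U_cases[of n]
  proof
    assume "U n = boundary_paths G"
    then show ?thesis using V(2) D(1) by blast
  next
    assume "U n \<in> \<U>"
    then show ?thesis by (rule dense[OF _ V])
  qed
  \<comment> \<open>The cylinder of \<open>e n\<close> is either to contain the next set or to be
    missed by its trace on \<open>D\<close>; deciding it on traces is what
    \<open>boundary_limit\<close> asks for.\<close>
  define Q where "Q n V V' \<longleftrightarrow> V' \<subseteq> V \<inter> U n \<and> (V' \<subseteq> cyl G (e n) \<or> V' \<inter> D \<inter> cyl G (e n) = {})"
    for n V V'
  have "\<exists>V. \<forall>n. (basic (V n) \<and> V n \<inter> D \<noteq> {}) \<and> Q n (V n) (V (Suc n))"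
  proof (rule dependent_nat_choice)
    have "openin ?T (cyl G (prange x))" "cyl G (prange x) \<inter> D \<noteq> {}"
      using x D in_cyl_prange openin_cyl cyl_in_paths by blast+
    then show "\<exists>V. basic V \<and> V \<inter> D \<noteq> {}" using shrink by blast
  next
    fix V n assume "basic V \<and> V \<inter> D \<noteq> {}"
    then have V: "openin ?T (V \<inter> U n)" "V \<inter> U n \<inter> D \<noteq> {}"
      using U_dense U_open basic_open by blast+
    have ce: "openin ?T (cyl G (e n))" using e openin_cyl by blast
    show "\<exists>V'. (basic V' \<and> V' \<inter> D \<noteq> {}) \<and> Q n V V'"
    proof (cases "V \<inter> U n \<inter> cyl G (e n) \<inter> D = {}")
      case True
      then show ?thesis using shrink[OF V] unfolding Q_def by blast
    next
      case False
      then show ?thesis using shrink[OF openin_Int[OF V(1) ce]] unfolding Q_def by blast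
    qed
  qed
  then obtain V where V: "\<And>n. basic (V n)" "\<And>n. V n \<inter> D \<noteq> {}" "\<And>n. Q n (V n) (V (Suc n))" by blast
  have sub: "V (Suc n) \<subseteq> V n \<inter> U n" for n using V(3)[of n] by (simp add: Q_def)
  then have dec: "V n \<subseteq> V m" if "m \<le> n" for m n
    using lift_Suc_antimono_le[of V m n] that by blast
  obtain v F where "v \<in> paths G" "V 0 = cyl_diff G v F" using V(1)[of 0] by (auto simp: basic_def)
  then have v: "V 0 \<inter> D \<subseteq> cyl G v" using cyl_diff_subset by blast
  obtain w where w: "w \<in> boundary_paths G" "\<And>b. w \<in> cyl G b \<longleftrightarrow> (\<exists>j. V j \<inter> D \<subseteq> cyl G b)"
  proof (rule boundary_limit[of "\<lambda>n. V n \<inter> D" v])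
    show "decseq (\<lambda>n. V n \<inter> D)" using dec by (auto simp: decseq_def)
    show "\<exists>j. V j \<inter> D \<subseteq> cyl G b \<or> V j \<inter> D \<inter> cyl G b = {}" if b: "b \<in> paths G" for b
    proof -
      obtain n where "b = e n" using e b by blast
      then have "V (Suc n) \<inter> D \<subseteq> cyl G b \<or> V (Suc n) \<inter> D \<inter> cyl G b = {}"
        using V(3)[of n] unfolding Q_def by blast
      then show ?thesis by blast
    qed
  qed (use V(2) v D in auto)
  \<comment> \<open>An excluded cylinder containing \<open>w\<close> would contain the trace on
    \<open>D\<close> of a later stage, which is nonempty and lies in \<open>V n\<close>.\<close>
  have "w \<in> V n" for n
  proof -
    obtain a F where aF: "V n = cyl_diff G a F" using V(1)[of n] by (auto simp: basic_def)
    then have "w \<in> cyl G a" using w(2) cyl_diff_subset by blast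
    moreover have "w \<notin> cyl G (cmp G a c)" if c: "c \<in> F" for c
    proof
      assume "w \<in> cyl G (cmp G a c)"
      then obtain j where j: "V j \<inter> D \<subseteq> cyl G (cmp G a c)" using w(2) by blast
      have "V (max j n) \<subseteq> V j" "V (max j n) \<subseteq> V n" using dec by simp_all
      then have "V (max j n) \<inter> D \<subseteq> cyl G (cmp G a c) \<inter> cyl_diff G a F" using j aF by blast
      then show False using V(2)[of "max j n"] c unfolding cyl_diff_def by blast
    qed
    ultimately show ?thesis using aF by (auto simp: cyl_diff_def)
  qed
  then have "w \<in> U n" for n using sub by blast
  then have wU: "w \<in> \<Inter>\<U>" using U unfolding \<U>'_def by (metis InterI insertCI rangeE)
  \<comment> \<open>Each of the finitely many excluded cylinders is missed by the trace of some
    stage, and the cylinder of \<open>a\<close> contains another; the latest of these stages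
    supplies a point of \<open>D\<close> in the neighbourhood.\<close>
  have "W \<inter> D \<noteq> {}" if W: "openin ?T W" "w \<in> W" for W
  proof -
    obtain a F where aF: "a \<in> paths G" "finite F" "F \<subseteq> vpaths G (src G a)" "w \<in> cyl_diff G a F" "cyl_diff G a F \<subseteq> W"
      using W openin_boundary_iff unfolding contains_nbhd_def by blast
    have "\<exists>j. V j \<inter> D \<inter> cyl G (cmp G a c) = {}" if c: "c \<in> F" for c
    proof -
      have "cmp G a c \<in> paths G" using c aF cmp_in by (auto simp: vpaths_def)
      then obtain n where n: "cmp G a c = e n" using e by blast
      have "w \<notin> cyl G (cmp G a c)" using aF c by (auto simp: cyl_diff_def)
      then have "\<not> V (Suc n) \<subseteq> cyl G (cmp G a c)" using w(2) by blast
      then have "V (Suc n) \<inter> D \<inter> cyl G (cmp G a c) = {}" using V(3)[of n] n by (simp add: Q_def)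
      then show ?thesis by blast
    qed
    then have "\<forall>c\<in>F. \<exists>j. V j \<inter> D \<inter> cyl G (cmp G a c) = {}" by simp
    from bchoice[OF this] obtain j where
      j: "\<And>c. c \<in> F \<Longrightarrow> V (j c) \<inter> D \<inter> cyl G (cmp G a c) = {}" by blast
    have "w \<in> cyl G a" using aF(4) cyl_diff_subset by blast
    then obtain i where i: "V i \<inter> D \<subseteq> cyl G a" using w(2)[of a] by blast
    let ?N = "Max (insert i (j ` F))"
    have N: "i \<le> ?N" "\<And>c. c \<in> F \<Longrightarrow> j c \<le> ?N" using aF(2) by auto
    obtain y where y: "y \<in> V ?N" "y \<in> D" using V(2)[of ?N] by blast
    have "y \<in> cyl G a" using i dec[OF N(1)] y by blast
    moreover have "y \<notin> cyl G (cmp G a c)" if "c \<in> F" for c using j[OF that] dec[OF N(2)[OF that]] y by blast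
    ultimately have "y \<in> cyl_diff G a F" by (auto simp: cyl_diff_def)
    then show ?thesis using aF(5) y(2) by blast
  qed
  then show ?thesis by (rule that[OF w(1) wU])
qed

section \<open>Orbits\<close>

abbreviation orb :: "('a, 'k) gpath \<Rightarrow> ('a, 'k) gpath set" where
  "orb \<equiv> orbit (boundary_path_groupoid G)"

lemma orbI:
  assumes "x \<in> boundary_paths G" "y \<in> boundary_paths G" "emb p \<le> pdeg x" "emb q \<le> pdeg y" "shift p x = shift q y"
  shows "y \<in> orb x"
  using assms by (auto simp: orbit_boundary_path_groupoid)

lemma orb_refl: "x \<in> boundary_paths G \<Longrightarrow> x \<in> orb x"
  by (rule orbI[of x x 0 0]) simp_all

lemma orb_subset: "x \<in> boundary_paths G \<Longrightarrow> orb x \<subseteq> boundary_paths G"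
  by (auto simp: orbit_boundary_path_groupoid)

lemma orb_sym:
  assumes "x \<in> boundary_paths G" "y \<in> orb x"
  shows "x \<in> orb y"
proof -
  obtain p q where "emb p \<le> pdeg x" "emb q \<le> pdeg y" "shift p x = shift q y" "y \<in> boundary_paths G"
    using assms by (auto simp: orbit_boundary_path_groupoid)
  then show ?thesis using orbI[of y x q p] assms(1) by simp
qed

text \<open>The common tail can be taken arbitrarily late in \<open>y\<close>: shifting both sides
  further by \<open>?r\<close> preserves the equality.\<close>

lemma orbE:
  assumes "x \<in> boundary_paths G" "y \<in> orb x" "emb n \<le> pdeg y"
  obtains p q where "n \<le> q" "emb p \<le> pdeg x" "emb q \<le> pdeg y" "shift p x = shift q y" "y \<in> boundary_paths G"
proof -
  obtain p q where pq: "emb p \<le> pdeg x" "emb q \<le> pdeg y" "shift p x = shift q y" and y: "y \<in> boundary_paths G"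
    using assms(1,2) by (auto simp: orbit_boundary_path_groupoid)
  let ?N = "sup n q"
  let ?r = "?N - q"
  have N: "?r + q = ?N" using tuple_le_add_diff[of q ?N] by (simp add: add.commute)
  have "emb ?N \<le> pdeg y" using assms(3) pq by (simp add: emb_sup_le_iff)
  moreover from this have "emb ?r \<le> pdeg y - emb q" using emb_le_diff_iff[OF pq(2)] N by metis
  then have "emb ?r \<le> pdeg x - emb p" using pq(3) by (metis pdeg_shift)
  then have "emb (?r + p) \<le> pdeg x" using pq(1) by (simp add: emb_le_diff_iff)
  moreover have "shift (?r + p) x = shift ?N y"
    using shift_shift[of ?r p x] shift_shift[of ?r q y] calculation pq(3) by (simp add: N)
  ultimately show ?thesis using that[of ?N "?r + p"] y by simp
qed

text \<open>Two tails of \<open>y\<close> are involved. By \<open>orbE\<close> the one shared with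
  \<open>x\<close> may be chosen later than the one shared with \<open>z\<close>, and shifting by
  the difference aligns them.\<close>

lemma orb_trans:
  assumes x: "x \<in> boundary_paths G" and y: "y \<in> orb x" and z: "z \<in> orb y"
  shows "z \<in> orb x"
proof -
  have yb: "y \<in> boundary_paths G" using orb_subset x y by blast
  have zb: "z \<in> boundary_paths G" using orb_subset yb z by blast
  obtain p q where pq: "emb p \<le> pdeg z" "emb q \<le> pdeg y" "shift p z = shift q y"
    using orbE[OF zb orb_sym[OF yb z] emb_zero_le] by metis
  obtain p' q' where pq': "q \<le> q'" "emb p' \<le> pdeg x" "emb q' \<le> pdeg y" "shift p' x = shift q' y"
    using orbE[OF x y pq(2)] by blast
  have q: "q' - q + q = q'" using tuple_le_add_diff[OF pq'(1)] by (simp add: add.commute)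
  then have "emb (q' - q) \<le> pdeg y - emb q" using emb_le_diff_iff[OF pq(2)] pq'(3) by metis
  then have "emb (q' - q) \<le> pdeg z - emb p" using pq(3) by (metis pdeg_shift)
  then have r: "emb (q' - q + p) \<le> pdeg z" using pq(1) by (simp add: emb_le_diff_iff)
  then have "shift (q' - q + p) z = shift q' y"
    using shift_shift[of "q' - q" p z] shift_shift[of "q' - q" q y] pq pq' by (simp add: q)
  then show ?thesis using orbI[OF x zb pq'(2) r] pq'(4) by simp
qed

lemma orb_eq_iff:
  assumes x: "x \<in> boundary_paths G" and y: "y \<in> boundary_paths G"
  shows "orb x = orb y \<longleftrightarrow> y \<in> orb x"
proof
  assume xy: "y \<in> orb x"
  show "orb x = orb y"
    using orb_trans[OF x xy] orb_trans[OF y orb_sym[OF x xy]] by blast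
qed (use orb_refl[OF y] in simp)

text \<open>
  Tail-equivalent paths have homeomorphic neighbourhoods: replace the initial segment
  \<open>x(0, p)\<close> by \<open>y(0, q)\<close>.
\<close>

lemma transport:
  assumes x: "x \<in> boundary_paths G" "emb p \<le> pdeg x" and y: "y \<in> boundary_paths G" "emb q \<le> pdeg y"
    and xy: "shift p x = shift q y" and K: "K \<subseteq> vpaths G (src G (pmap y (0, q)))"
    and u: "u \<in> cyl_diff G (pmap x (0, p)) K"
  obtains v where "v \<in> cyl_diff G (pmap y (0, q)) K" "shift p u = shift q v" "v \<in> orb u" "u \<in> boundary_paths G"
proof -
  let ?a = "pmap x (0, p)" and ?b = "pmap y (0, q)"
  note a = initial[OF boundary_functor_path[OF x(1)] x(2)]
    and b = initial[OF boundary_functor_path[OF y(1)] y(2)]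
  have range_shift: "prange (shift r z) = pmap z (r, r)" if "emb r \<le> pdeg z" for r z
    using that pmap_shift[of r z 0 0] by (simp add: prange_def)
  have ab: "src G ?a = src G ?b" using a(3) b(3) xy range_shift x(2) y(2) by metis
  have ua: "u \<in> cyl G ?a" and uK: "\<And>c. c \<in> K \<Longrightarrow> u \<notin> cyl G (cmp G ?a c)"
    using u by (auto simp: cyl_diff_def)
  have ub: "u \<in> boundary_paths G" "emb p \<le> pdeg u" "pmap u (0, p) = ?a"
    using ua a(4) by (auto simp: cyl_iff)
  have "prange (shift p u) = src G ?b"
    using range_shift[OF ub(2)] initial(3)[OF boundary_functor_path[OF ub(1)] ub(2)] ub(3) ab by simp
  then obtain v where v: "v \<in> cyl G ?b" "shift q v = shift p u"
    using ex_prepend[OF b(1) boundary_shift[OF ub(1,2)]] b(4) by metis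
  have "v \<notin> cyl G (cmp G ?b c)" if c: "c \<in> K" for c
  proof -
    have cG: "c \<in> paths G" "src G ?b = rng G c" using c K by (auto simp: vpaths_def)
    then have "shift p u \<notin> cyl G c" using uK[OF c] cyl_cmp_iff[OF a(1) cG(1)] ua a(4) ab by simp
    then show ?thesis using cyl_cmp_iff[OF b(1) cG] b(4) v(2) by simp
  qed
  then have "v \<in> cyl_diff G ?b K" using v(1) by (auto simp: cyl_diff_def)
  moreover have "v \<in> orb u"
  proof (rule orbI[OF ub(1) _ ub(2)])
    show "v \<in> boundary_paths G" "emb q \<le> pdeg v" using v(1) b(4) by (auto simp: cyl_iff)
  qed (use v(2) in simp)
  ultimately show ?thesis using that v(2) ub(1) by simp
qed

text \<open>Pulls a neighbourhood of \<open>y\<close> back to \<open>x\<close>. The first conclusion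
  about \<open>u\<close> makes saturations open; the second rests on injectivity of the transport,
  under which only \<open>x\<close> goes to \<open>y\<close>, and serves to move isolated
  points.\<close>

lemma transport_nbhd:
  assumes x: "x \<in> boundary_paths G" and y: "y \<in> orb x" and V: "contains_nbhd V y"
  obtains a F where "a \<in> paths G" "finite F" "F \<subseteq> vpaths G (src G a)" "x \<in> cyl_diff G a F"
    "\<And>u. u \<in> cyl_diff G a F \<Longrightarrow> orb u \<inter> V \<noteq> {}"
    "\<And>u. u \<in> cyl_diff G a F \<Longrightarrow> u \<noteq> x \<Longrightarrow> orb u \<inter> V - {y} \<noteq> {}"
proof -
  have yb: "y \<in> boundary_paths G" using orb_subset x y by blast
  obtain a0 F0 where aF0: "finite F0" "F0 \<subseteq> vpaths G (src G a0)" "y \<in> cyl_diff G a0 F0" "cyl_diff G a0 F0 \<subseteq> V"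
    using V by (auto simp: contains_nbhd_def)
  then have "emb (deg G a0) \<le> pdeg y" by (auto simp: cyl_diff_def cyl_iff[of y a0])
  then obtain p q where pq: "deg G a0 \<le> q" "emb p \<le> pdeg x" "emb q \<le> pdeg y" "shift p x = shift q y"
    using orbE[OF x y] by blast
  obtain K where K: "finite K" "K \<subseteq> vpaths G (src G (pmap y (0, q)))"
    "y \<in> cyl_diff G (pmap y (0, q)) K" "cyl_diff G (pmap y (0, q)) K \<subseteq> cyl_diff G a0 F0"
    by (rule cyl_diff_refine[OF aF0(3,1,2) pq(3,1)])
  have KV: "cyl_diff G (pmap y (0, q)) K \<subseteq> V" using K(4) aF0(4) by (rule order_trans)
  let ?a = "pmap x (0, p)" and ?b = "pmap y (0, q)"
  note a = initial[OF boundary_functor_path[OF x] pq(2)]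
    and b = initial[OF boundary_functor_path[OF yb] pq(3)]
  have ab: "src G ?a = src G ?b"
    using a(3) b(3) pmap_shift[OF pq(2), of 0 0] pmap_shift[OF pq(3), of 0 0] pq(2-4) by simp
  have Ka: "K \<subseteq> vpaths G (src G ?a)" using K(2) ab by simp
  \<comment> \<open>Transporting \<open>y\<close> backwards can only give \<open>x\<close>, which
    shows that \<open>x\<close> avoids the excluded cylinders.\<close>
  obtain x' where x': "x' \<in> cyl_diff G ?a K" "shift q y = shift p x'"
    by (rule transport[OF yb pq(3) x pq(2) pq(4)[symmetric] Ka K(3)])
  have inj: "u = x" if "u \<in> cyl G ?a" "shift p u = shift p x" for u
    using cyl_prepend_inject[OF that(1) in_cyl_initial[OF x pq(2)]] that(2) a(4) by simp
  have "x' = x" using inj[of x'] x' pq(4) cyl_diff_subset by auto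
  then have xK: "x \<in> cyl_diff G ?a K" using x' by simp
  have "\<exists>v. v \<in> orb u \<inter> V \<and> shift p u = shift q v" if u: "u \<in> cyl_diff G ?a K" for u
  proof -
    obtain v where "v \<in> cyl_diff G ?b K" "shift p u = shift q v" "v \<in> orb u"
      by (rule transport[OF x pq(2) yb pq(3,4) K(2) u])
    then show ?thesis using KV by blast
  qed
  note moved = this
  have moved': "orb u \<inter> V - {y} \<noteq> {}" if u: "u \<in> cyl_diff G ?a K" "u \<noteq> x" for u
  proof -
    obtain v where v: "v \<in> orb u \<inter> V" "shift p u = shift q v" using moved[OF u(1)] by blast
    have "u \<in> cyl G ?a" using u(1) cyl_diff_subset by blast
    then have "v \<noteq> y" using inj[of u] u(2) v(2) pq(4) by auto
    then show ?thesis using v(1) by blast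
  qed
  show ?thesis
    by (rule that[OF a(1) K(1) Ka xK _ moved']) (use moved in blast)
qed

section \<open>Saturations and open sets of the orbit space\<close>

definition saturation :: "('a, 'k) gpath set \<Rightarrow> ('a, 'k) gpath set" where
  "saturation V = {x \<in> boundary_paths G. orb x \<inter> V \<noteq> {}}"

text \<open>In other words, the quotient map onto the orbit space is open. Around a point of the
  saturation, \<open>transport_nbhd\<close> gives a basic set whose points all have orbits meeting
  \<open>V\<close>.\<close>

lemma openin_saturation:
  assumes "openin (boundary_topology G) V"
  shows "openin (boundary_topology G) (saturation V)"
  unfolding openin_boundary_iff
proof
  fix x assume "x \<in> saturation V"
  then obtain y where x: "x \<in> boundary_paths G" and y: "y \<in> orb x" "y \<in> V" by (auto simp: saturation_def)
  have "contains_nbhd V y" using assms y(2) openin_boundary_iff by blast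
  from transport_nbhd[OF x y(1) this] obtain a F where aF: "a \<in> paths G" "finite F" "F \<subseteq> vpaths G (src G a)"
    "x \<in> cyl_diff G a F" "\<And>u. u \<in> cyl_diff G a F \<Longrightarrow> orb u \<inter> V \<noteq> {}" by metis
  moreover have "cyl_diff G a F \<subseteq> boundary_paths G" by (auto simp: cyl_diff_def cyl_def)
  ultimately show "contains_nbhd (saturation V) x"
    unfolding contains_nbhd_def saturation_def by blast
qed

lemma orb_saturation:
  assumes "x \<in> boundary_paths G" "y \<in> orb x"
  shows "y \<in> saturation V \<longleftrightarrow> x \<in> saturation V"
proof -
  have y: "y \<in> boundary_paths G" using orb_subset assms by blast
  then have "orb x = orb y" using orb_eq_iff assms by simp
  then show ?thesis using assms(1) y by (simp add: saturation_def)
qed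

text \<open>Open sets of orbits correspond to open saturated sets: \<open>down\<close> takes the
  preimage and \<open>up\<close> the image of a saturation. Hence two orbits are topologically
  indistinguishable exactly when they meet the same open sets of paths.\<close>

lemma t0_orbit_space_iff:
  "t0_space (orbit_space (boundary_path_groupoid G)) \<longleftrightarrow>
    (\<forall>x\<in>boundary_paths G. \<forall>y\<in>boundary_paths G.
      (\<forall>V. openin (boundary_topology G) V \<longrightarrow> (orb x \<inter> V \<noteq> {} \<longleftrightarrow> orb y \<inter> V \<noteq> {})) \<longrightarrow> orb x = orb y)"
    (is "?T0 \<longleftrightarrow> ?R")
proof -
  let ?X = "boundary_topology G" and ?Q = "orbit_space (boundary_path_groupoid G)"
  have unit: "unit_topology (boundary_path_groupoid G) = ?X" by (simp add: boundary_path_groupoid_def)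
  have top: "topspace ?Q = orb ` boundary_paths G"
    by (simp add: orbit_space_def topspace_quotient_topology unit topspace_boundary_topology)
  have op: "openin ?Q W \<longleftrightarrow> W \<subseteq> orb ` boundary_paths G \<and> openin ?X {x \<in> boundary_paths G. orb x \<in> W}" for W
    by (simp add: orbit_space_def openin_quotient_topology unit topspace_boundary_topology)
  have down: "\<exists>V. openin ?X V \<and> (\<forall>x\<in>boundary_paths G. orb x \<inter> V \<noteq> {} \<longleftrightarrow> orb x \<in> W)" if "openin ?Q W" for W
  proof (intro exI conjI ballI)
    show "openin ?X {x \<in> boundary_paths G. orb x \<in> W}" using that op by blast
    fix x assume x: "x \<in> boundary_paths G"
    have "orb y = orb x" "y \<in> boundary_paths G" if "y \<in> orb x" for y
      using orb_eq_iff[OF x, of y] that orb_subset[OF x] by blast+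
    then have "orb x \<in> W" if "orb x \<inter> {x \<in> boundary_paths G. orb x \<in> W} \<noteq> {}"
      using that by (metis (no_types, lifting) disjoint_iff mem_Collect_eq)
    moreover have "x \<in> orb x \<inter> {x \<in> boundary_paths G. orb x \<in> W}" if "orb x \<in> W"
      using orb_refl[OF x] x that by simp
    ultimately show "orb x \<inter> {x \<in> boundary_paths G. orb x \<in> W} \<noteq> {} \<longleftrightarrow> orb x \<in> W"
      by blast
  qed
  have up: "\<exists>W. openin ?Q W \<and> (\<forall>x\<in>boundary_paths G. orb x \<inter> V \<noteq> {} \<longleftrightarrow> orb x \<in> W)" if V: "openin ?X V" for V
  proof (intro exI conjI ballI)
    let ?W = "orb ` saturation V"
    have sat: "orb x \<in> ?W \<longleftrightarrow> x \<in> saturation V" if "x \<in> boundary_paths G" for x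
      using that by (auto simp: saturation_def)
    have "{x \<in> boundary_paths G. orb x \<in> ?W} = saturation V"
      using sat by (auto simp: saturation_def)
    then show "openin ?Q ?W" using openin_saturation[OF V] op by (auto simp: saturation_def)
    show "orb x \<inter> V \<noteq> {} \<longleftrightarrow> orb x \<in> ?W" if "x \<in> boundary_paths G" for x
      using sat[OF that] that by (auto simp: saturation_def)
  qed
  have "?T0 \<longleftrightarrow> (\<forall>x\<in>boundary_paths G. \<forall>y\<in>boundary_paths G.
      (\<forall>W. openin ?Q W \<longrightarrow> (orb x \<in> W \<longleftrightarrow> orb y \<in> W)) \<longrightarrow> orb x = orb y)"
    unfolding t0_space_def top by blast
  also have "\<dots> \<longleftrightarrow> ?R"
  proof -
    have "(\<forall>W. openin ?Q W \<longrightarrow> (orb x \<in> W \<longleftrightarrow> orb y \<in> W)) \<longleftrightarrow>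
        (\<forall>V. openin ?X V \<longrightarrow> (orb x \<inter> V \<noteq> {} \<longleftrightarrow> orb y \<inter> V \<noteq> {}))"
      if "x \<in> boundary_paths G" "y \<in> boundary_paths G" for x y
      using up down that by meson
    then show ?thesis by simp
  qed
  finally show ?thesis .
qed

text \<open>A path in the orbit is recovered from an initial segment and the amount by which
  \<open>x\<close> is shifted to reach the common tail; both vary over countable sets.\<close>

lemma countable_orb:
  assumes "countable (paths G)" and x: "x \<in> boundary_paths G"
  shows "countable (orb x)"
proof -
  \<comment> \<open>Pairs that determine no path receive an arbitrary value, which is harmless since
    only an inclusion into the image is claimed.\<close>
  let ?f = "\<lambda>(a, p). THE y. y \<in> cyl G a \<and> shift (deg G a) y = shift p x"
  have "orb x \<subseteq> ?f ` (paths G \<times> UNIV)"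
  proof
    fix y assume "y \<in> orb x"
    then obtain p q where pq: "emb q \<le> pdeg y" "shift p x = shift q y" "y \<in> boundary_paths G"
      using orbE[OF x _ emb_zero_le, of y] by metis
    let ?a = "pmap y (0, q)"
    note a = initial[OF boundary_functor_path[OF pq(3)] pq(1)]
    have "(THE z. z \<in> cyl G ?a \<and> shift (deg G ?a) z = shift p x) = y"
      using in_cyl_initial[OF pq(3,1)] pq(2) a(4) cyl_prepend_inject[of _ ?a y]
      by (intro the_equality) auto
    then show "y \<in> ?f ` (paths G \<times> UNIV)" using a(1) by (intro image_eqI[of _ _ "(?a, p)"]) auto
  qed
  then show ?thesis
    by (rule countable_subset) (intro countable_image countable_SIGMA assms(1) countableI_type)
qed

section \<open>Points isolated in their orbits\<close>

definition isolated_in_orbit :: "('a, 'k) gpath \<Rightarrow> bool" where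
  "isolated_in_orbit x \<longleftrightarrow> (\<exists>a\<in>paths G. \<exists>F. finite F \<and> F \<subseteq> vpaths G (src G a)
     \<and> cyl_diff G a F \<inter> orb x = {x})"

text \<open>Homogeneity of orbits: a single isolated point \<open>y\<close> makes \<open>x\<close>
  isolated as well, because a second orbit point in the transported neighbourhood of
  \<open>x\<close> would put an orbit point other than \<open>y\<close> into
  \<open>V\<close>.\<close>

lemma isolated_in_orbitI:
  assumes x: "x \<in> boundary_paths G" and V: "openin (boundary_topology G) V" "V \<inter> orb x = {y}"
  shows "isolated_in_orbit x"
proof -
  have y: "y \<in> orb x" "contains_nbhd V y" using V openin_boundary_iff by blast+
  from transport_nbhd[OF x y] obtain a F where aF: "a \<in> paths G" "finite F" "F \<subseteq> vpaths G (src G a)"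
    "x \<in> cyl_diff G a F" "\<And>u. u \<in> cyl_diff G a F \<Longrightarrow> u \<noteq> x \<Longrightarrow> orb u \<inter> V - {y} \<noteq> {}" by metis
  have "u = x" if "u \<in> cyl_diff G a F" "u \<in> orb x" for u
    using aF(5)[OF that(1)] orb_trans[OF x that(2)] V(2) by blast
  then show ?thesis using aF(1-4) orb_refl[OF x] unfolding isolated_in_orbit_def by blast
qed

lemma t0_imp_isolated:
  assumes count: "countable (paths G)" and t0: "t0_space (orbit_space (boundary_path_groupoid G))"
    and x: "x \<in> boundary_paths G"
  shows "isolated_in_orbit x"
proof (rule ccontr)
  assume not_isolated: "\<not> isolated_in_orbit x"
  let ?X = "boundary_topology G" and ?D = "orb x"
  let ?B = "{cyl_diff G a F | a F. a \<in> paths G \<and> finite F \<and> F \<subseteq> vpaths G (src G a)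
     \<and> cyl_diff G a F \<inter> ?D \<noteq> {}}"
  \<comment> \<open>The first sets keep \<open>w\<close> away from every point of the orbit of
    \<open>x\<close>; the others make the orbit of \<open>w\<close> meet every basic set that this
    orbit meets. Both families are countable.\<close>
  let ?\<U> = "(\<lambda>y. boundary_paths G - {y}) ` ?D \<union> saturation ` ?B"
  have "?B \<subseteq> (\<lambda>(a, F). cyl_diff G a F) ` (paths G \<times> {F. finite F \<and> F \<subseteq> paths G})"
    by (force simp: vpaths_def)
  moreover have "countable ((\<lambda>(a, F). cyl_diff G a F) ` (paths G \<times> {F. finite F \<and> F \<subseteq> paths G}))"
    using count by (intro countable_image countable_SIGMA countable_Collect_finite_subset)
  ultimately have "countable ?B" by (rule countable_subset)
  then have "countable ?\<U>" using countable_orb[OF count x] by blast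
  moreover have "openin ?X U" if "U \<in> ?\<U>" for U
    using that openin_remove_point openin_saturation openin_cyl_diff by auto
  moreover have "V \<inter> U \<inter> ?D \<noteq> {}" if "U \<in> ?\<U>" and V: "openin ?X V" "V \<inter> ?D \<noteq> {}" for U V
  proof -
    consider y where "y \<in> ?D" "U = boundary_paths G - {y}" | B where "B \<in> ?B" "U = saturation B"
      using \<open>U \<in> ?\<U>\<close> by blast
    then show ?thesis
    proof cases
      case 1
      show ?thesis
      proof
        \<comment> \<open>Density could fail only if \<open>y\<close> were the sole orbit point in
          \<open>V\<close>, which homogeneity excludes.\<close>
        assume "V \<inter> U \<inter> ?D = {}"
        then have "V \<inter> ?D = {y}" using 1 V(2) orb_subset[OF x] by blast
        then show False using isolated_in_orbitI[OF x V(1)] not_isolated by blast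
      qed
    next
      case 2
      \<comment> \<open>A saturation that meets an orbit contains all of it, so density holds at
        once.\<close>
      then have "x \<in> saturation B" using x by (auto simp: saturation_def)
      then have "?D \<subseteq> U" using orb_saturation[OF x] 2 by blast
      then show ?thesis using V(2) by blast
    qed
  qed
  ultimately obtain w where w: "w \<in> boundary_paths G" "w \<in> \<Inter>?\<U>"
    and closure: "\<And>V. openin ?X V \<Longrightarrow> w \<in> V \<Longrightarrow> V \<inter> ?D \<noteq> {}"
    using closure_meets_dense_opens[OF count orb_subset[OF x], of ?\<U>] orb_refl[OF x] by blast
  have "orb w \<inter> V \<noteq> {}" if V: "openin ?X V" "?D \<inter> V \<noteq> {}" for V
  proof -
    obtain y where y: "y \<in> ?D" "y \<in> V" using V(2) by blast
    then obtain a F where aF: "a \<in> paths G" "finite F" "F \<subseteq> vpaths G (src G a)" "y \<in> cyl_diff G a F" "cyl_diff G a F \<subseteq> V"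
      using V(1) openin_boundary_iff unfolding contains_nbhd_def by blast
    then have "cyl_diff G a F \<in> ?B" using y(1) by blast
    then have "w \<in> saturation (cyl_diff G a F)" by (intro InterD[OF w(2)] UnI2 imageI)
    then show ?thesis using aF(5) by (auto simp: saturation_def)
  qed
  \<comment> \<open>Here \<open>w\<close> being in the closure of the orbit is used, with the open
    saturation of \<open>V\<close> as its neighbourhood.\<close>
  moreover have "?D \<inter> V \<noteq> {}" if V: "openin ?X V" "orb w \<inter> V \<noteq> {}" for V
  proof -
    have "w \<in> saturation V" using V(2) w(1) by (simp add: saturation_def)
    then obtain y where "y \<in> ?D" "y \<in> saturation V" using closure[OF openin_saturation[OF V(1)]] by blast
    then have "x \<in> saturation V" using orb_saturation[OF x] by blast
    then show ?thesis by (simp add: saturation_def)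
  qed
  ultimately have "\<forall>V. openin ?X V \<longrightarrow> (orb x \<inter> V \<noteq> {} \<longleftrightarrow> orb w \<inter> V \<noteq> {})" by metis
  then have "orb x = orb w" 
    by (rule t0[unfolded t0_orbit_space_iff, THEN bspec, OF x, THEN bspec, OF w(1), THEN mp])
  then have "w \<in> ?D" using orb_refl[OF w(1)] by simp
  then have "boundary_paths G - {w} \<in> ?\<U>" by (intro UnI1 image_eqI[of _ _ w]) simp_all
  then have "w \<in> boundary_paths G - {w}" by (rule InterD[OF w(2)])
  then show False by simp
qed

lemma isolated_imp_t0:
  assumes "\<And>x. x \<in> boundary_paths G \<Longrightarrow> isolated_in_orbit x"
  shows "t0_space (orbit_space (boundary_path_groupoid G))"
  unfolding t0_orbit_space_iff
proof (intro ballI impI)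
  let ?X = "boundary_topology G"
  fix x y assume x: "x \<in> boundary_paths G" and y: "y \<in> boundary_paths G"
    and same: "\<forall>V. openin ?X V \<longrightarrow> (orb x \<inter> V \<noteq> {} \<longleftrightarrow> orb y \<inter> V \<noteq> {})"
  obtain a F where "a \<in> paths G" "finite F" "F \<subseteq> vpaths G (src G a)" and iso: "cyl_diff G a F \<inter> orb x = {x}"
    using assms[OF x] by (auto simp: isolated_in_orbit_def)
  then have op: "openin ?X (cyl_diff G a F)" by (simp add: openin_cyl_diff)
  then obtain z where z: "z \<in> orb y" "z \<in> cyl_diff G a F" using same iso by blast
  \<comment> \<open>Without \<open>x\<close> the isolating set is still open and misses the orbit of
    \<open>x\<close>, hence also that of \<open>y\<close>. So the point \<open>z\<close> where the
    orbit of \<open>y\<close> meets the isolating set must be \<open>x\<close>.\<close>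
  have "openin ?X (cyl_diff G a F \<inter> (boundary_paths G - {x}))"
    using op openin_remove_point by (rule openin_Int)
  moreover have "orb x \<inter> (cyl_diff G a F \<inter> (boundary_paths G - {x})) = {}" using iso by blast
  ultimately have "orb y \<inter> (cyl_diff G a F \<inter> (boundary_paths G - {x})) = {}" using same by blast
  then have "z = x" using z orb_subset[OF y] by blast
  then show "orb x = orb y" using orb_eq_iff[OF y x] z(1) by simp
qed

end

section \<open>The characterization of T0 orbit spaces\<close>

theorem proposition8p3:
  fixes G :: "('a, 'k::finite) hrgraph"
  assumes "higher_rank_graph G"
    and "countable (paths G)"
    and "finitely_aligned G"
  shows "t0_space (orbit_space (boundary_path_groupoid G)) \<longleftrightarrow>
    (\<forall>x\<in>boundary_paths G. \<exists>a\<in>paths G. \<exists>F. finite F \<and> F \<subseteq> vpaths G (src G a)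
       \<and> cyl_diff G a F \<inter> orbit (boundary_path_groupoid G) x = {x})"
proof -
  interpret finitely_aligned_graph G
    using assms by (simp add: finitely_aligned_graph_def finitely_aligned_graph_axioms_def)
  have "t0_space (orbit_space (boundary_path_groupoid G)) \<longleftrightarrow> (\<forall>x\<in>boundary_paths G. isolated_in_orbit x)"
    using t0_imp_isolated[OF assms(2)] isolated_imp_t0 by metis
  then show ?thesis by (simp only: isolated_in_orbit_def)
qed

end
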